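(* Let $V$ be a simple unitary VOA and assume that $\operatorname{Aut}(V)$ is a finite dimensional Lie group. If $G$ is a compact subgroup of $\operatorname{Aut}(V)$, then there exists an invariant normalized scalar product $\{\cdot|\cdot\}$ on $V$ such that $G\subset\operatorname{Aut}_{\{\cdot|\cdot\}}(V)$, namely the automorphisms in $G$ are unitary with respect to $\{\cdot|\cdot\}$.
   Context: A VOA $V=\bigoplus_{n\in\mathbb Z}V_n$ is over $\mathbb C$, with $V_n=\operatorname{Ker}(L_0-n)$ finite-dimensional, vacuum $\Omega$, conformal vector $\nu$. $\operatorname{Aut}(V)$ is the group of VOA automorphisms (fixing $\Omega$ and $\nu$), topologized as a closed subgroup of $\prod_{n}\mathrm{GL}(V_n)$ via $g\mapsto(g\restriction_{V_n})_n$. A normalized invariant scalar product on $V$ is a scalar product $(\cdot|\cdot)$ (positive definite, linear in the second variable) with $(\Omega|\Omega)=1$ for which there is an antilinear VOA automorphism $\theta$ with $\theta^2=1$ (the PCT operator) such that $(Y(\theta e^{zL_1}(-z^{-2})^{L_0}a,z^{-1})b|c)=(b|Y(a,z)c)$ for all $a,b,c\in V$. A unitary VOA is a VOA with such a scalar product. $\operatorname{Aut}_{(\cdot|\cdot)}(V)$ denotes the group of $g\in\operatorname{Aut}(V)$ with $(ga|ga)=(a|a)$ for all $a\in V$. *)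

theory Defs
  imports "HOL-Analysis.Analysis" "HOL-Algebra.Group"
begin

section \<open>Finite-dimensional Lie groups\<close>

text \<open>
  The dimension has to be existentially quantified and may be 0 (discrete groups), so the model
  spaces are the topologies \<^const>\<open>Euclidean_space\<close> \<open>n\<close> on sequences vanishing from index \<open>n\<close> on,
  rather than a type of class \<open>euclidean_space\<close>.
\<close>

primrec C_k :: "nat \<Rightarrow> nat \<Rightarrow> (nat \<Rightarrow> real) set \<Rightarrow> ((nat \<Rightarrow> real) \<Rightarrow> real) \<Rightarrow> bool" where
  "C_k n 0 U f \<longleftrightarrow> continuous_map (subtopology (Euclidean_space n) U) euclideanreal f"
| "C_k n (Suc k) U f \<longleftrightarrow>
     continuous_map (subtopology (Euclidean_space n) U) euclideanreal f \<and>
     (\<forall>i<n. (\<forall>x\<in>U. (\<lambda>t. f (x(i := t))) differentiable (at (x i))) \<and>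
            C_k n k U (\<lambda>x. deriv (\<lambda>t. f (x(i := t))) (x i)))"

text \<open>Maps from an open subset of \<open>\<real>\<^sup>n\<close> to \<open>\<real>\<^sup>m\<close> all of whose components are \<open>C\<^sup>\<infinity>\<close>.\<close>

definition smooth_map_on ::
    "nat \<Rightarrow> nat \<Rightarrow> (nat \<Rightarrow> real) set \<Rightarrow> ((nat \<Rightarrow> real) \<Rightarrow> (nat \<Rightarrow> real)) \<Rightarrow> bool" where
  "smooth_map_on n m U f \<longleftrightarrow>
     openin (Euclidean_space n) U \<and> f \<in> U \<rightarrow> topspace (Euclidean_space m) \<and>
     (\<forall>j<m. \<forall>k. C_k n k U (\<lambda>x. f x j))"

type_synonym 'a chart = "'a set \<times> ('a \<Rightarrow> (nat \<Rightarrow> real))"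

definition is_chart :: "nat \<Rightarrow> 'a topology \<Rightarrow> 'a chart \<Rightarrow> bool" where
  "is_chart n X = (\<lambda>(U, \<phi>).
     openin X U \<and> openin (Euclidean_space n) (\<phi> ` U) \<and>
     homeomorphic_map (subtopology X U) (subtopology (Euclidean_space n) (\<phi> ` U)) \<phi>)"

definition smooth_atlas :: "nat \<Rightarrow> 'a topology \<Rightarrow> 'a chart set \<Rightarrow> bool" where
  "smooth_atlas n X A \<longleftrightarrow>
     (\<forall>c\<in>A. is_chart n X c) \<and> (\<Union>(U, \<phi>)\<in>A. U) = topspace X \<and>
     (\<forall>(U, \<phi>)\<in>A. \<forall>(W, \<psi>)\<in>A.
        smooth_map_on n n (\<phi> ` (U \<inter> W)) (\<lambda>x. \<psi> (inv_into U \<phi> x)))"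

text \<open>The two projections under the identification \<open>\<real>\<^sup>n\<^sup>+\<^sup>n = \<real>\<^sup>n \<times> \<real>\<^sup>n\<close>.\<close>

definition fst_half :: "nat \<Rightarrow> (nat \<Rightarrow> real) \<Rightarrow> (nat \<Rightarrow> real)" where
  "fst_half n z = (\<lambda>i. if i < n then z i else 0)"

definition snd_half :: "nat \<Rightarrow> (nat \<Rightarrow> real) \<Rightarrow> (nat \<Rightarrow> real)" where
  "snd_half n z = (\<lambda>i. if i < n then z (n + i) else 0)"

text \<open>
  \<open>X\<close> is a topology on the group \<open>G\<close>; the Lie group structure is required to induce this topology.
\<close>

definition finite_dim_lie_group :: "('a, 'b) monoid_scheme \<Rightarrow> 'a topology \<Rightarrow> bool" where
  "finite_dim_lie_group G X \<longleftrightarrow>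
     group G \<and> topspace X = carrier G \<and> Hausdorff_space X \<and> second_countable X \<and>
     continuous_map (prod_topology X X) X (\<lambda>(x, y). x \<otimes>\<^bsub>G\<^esub> y) \<and>
     continuous_map X X (\<lambda>x. inv\<^bsub>G\<^esub> x) \<and>
     (\<exists>n A. smooth_atlas n X A \<and>
        (\<forall>(U, \<phi>)\<in>A. \<forall>(V, \<psi>)\<in>A. \<forall>(W, \<xi>)\<in>A.
           smooth_map_on (n + n) n
             {z \<in> topspace (Euclidean_space (n + n)).
                fst_half n z \<in> \<phi> ` U \<and> snd_half n z \<in> \<psi> ` V \<and>
                inv_into U \<phi> (fst_half n z) \<otimes>\<^bsub>G\<^esub> inv_into V \<psi> (snd_half n z) \<in> W}
             (\<lambda>z. \<xi> (inv_into U \<phi> (fst_half n z) \<otimes>\<^bsub>G\<^esub> inv_into V \<psi> (snd_half n z)))) \<and>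
        (\<forall>(U, \<phi>)\<in>A. \<forall>(W, \<xi>)\<in>A.
           smooth_map_on n n {x \<in> \<phi> ` U. inv\<^bsub>G\<^esub> (inv_into U \<phi> x) \<in> W}
             (\<lambda>x. \<xi> (inv\<^bsub>G\<^esub> (inv_into U \<phi> x)))))"


section \<open>Vertex operator algebras\<close>

text \<open>
  The state-field correspondence is given by its modes, \<open>Y a n = a\<^bsub>(n)\<^esub>\<close>, where
  \<open>Y(a,z) = \<Sum>\<^bsub>n\<^esub> a\<^bsub>(n)\<^esub> z\<^bsup>-n-1\<^esup>\<close>.
\<close>

definition virasoro_mode :: "('v \<Rightarrow> int \<Rightarrow> 'v \<Rightarrow> 'v) \<Rightarrow> 'v \<Rightarrow> int \<Rightarrow> 'v \<Rightarrow> 'v" where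
  "virasoro_mode Y \<nu> n = Y \<nu> (n + 1)"

definition weight_space ::
    "(complex \<Rightarrow> 'v \<Rightarrow> 'v) \<Rightarrow> ('v \<Rightarrow> int \<Rightarrow> 'v \<Rightarrow> 'v) \<Rightarrow> 'v \<Rightarrow> int \<Rightarrow> 'v set" where
  "weight_space scl Y \<nu> n = {a. virasoro_mode Y \<nu> 0 a = scl (of_int n) a}"

locale voa = vector_space scl
  for scl :: "complex \<Rightarrow> 'v::ab_group_add \<Rightarrow> 'v" (infixr \<open>*s\<close> 75) +
  fixes Y :: "'v \<Rightarrow> int \<Rightarrow> 'v \<Rightarrow> 'v"
    and \<Omega> :: 'v
    and \<nu> :: 'v
  assumes Y_linear_left: "Vector_Spaces.linear scl scl (\<lambda>a. Y a n b)"
    and Y_linear_right: "Vector_Spaces.linear scl scl (Y a n)"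
    and field: "\<exists>N. \<forall>n\<ge>N. Y a n b = 0"
    and vacuum_field: "Y \<Omega> n b = (if n = -1 then b else 0)"
    and creation: "Y a (-1) \<Omega> = a" "n \<ge> 0 \<Longrightarrow> Y a n \<Omega> = 0"
    \<comment> \<open>\<open>[L\<^bsub>-1\<^esub>, Y(a,z)] = d/dz Y(a,z)\<close>\<close>
    and translation_covariance:
      "virasoro_mode Y \<nu> (-1) (Y a n b) - Y a n (virasoro_mode Y \<nu> (-1) b)
         = of_int (- n) *s Y a (n - 1) b"
    and translation_vacuum: "virasoro_mode Y \<nu> (-1) \<Omega> = 0"
    \<comment> \<open>\<open>(z-w)\<^sup>N [Y(a,z), Y(b,w)] = 0\<close>, coefficient of \<open>z\<^bsup>-m-1\<^esup> w\<^bsup>-n-1\<^esup>\<close>\<close>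
    and locality:
      "\<exists>N::nat. \<forall>m n c. (\<Sum>j\<le>N. ((-1) ^ j * of_nat (N choose j)) *s
         (Y a (m + int (N - j)) (Y b (n + int j) c)
          - Y b (n + int j) (Y a (m + int (N - j)) c))) = 0"
    and virasoro:
      "\<exists>cc::complex. \<forall>m n a.
         virasoro_mode Y \<nu> m (virasoro_mode Y \<nu> n a) - virasoro_mode Y \<nu> n (virasoro_mode Y \<nu> m a)
         = of_int (m - n) *s virasoro_mode Y \<nu> (m + n) a
           + (if m + n = 0 then cc / 12 * of_int (m ^ 3 - m) else 0) *s a"
    \<comment> \<open>the sum of the weight spaces is automatically direct, these being eigenspaces\<close>
    and weight_decomposition: "span (\<Union>n. weight_space scl Y \<nu> n) = UNIV"
    and weight_finite_dim: "\<exists>B. finite B \<and> weight_space scl Y \<nu> n \<subseteq> span B"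
    and weight_bounded_below: "\<exists>N. \<forall>n<N. weight_space scl Y \<nu> n = {0}"
begin

abbreviation L :: "int \<Rightarrow> 'v \<Rightarrow> 'v" where "L \<equiv> virasoro_mode Y \<nu>"

abbreviation W :: "int \<Rightarrow> 'v set" where "W \<equiv> weight_space scl Y \<nu>"

text \<open>Invariance under the translation operator is the instance \<open>a = \<nu>\<close>, \<open>n = 0\<close>.\<close>

definition ideal :: "'v set \<Rightarrow> bool" where
  "ideal J \<longleftrightarrow> subspace J \<and> (\<forall>a n. \<forall>b\<in>J. Y a n b \<in> J)"

definition simple :: bool where
  "simple \<longleftrightarrow> (UNIV :: 'v set) \<noteq> {0} \<and> (\<forall>J. ideal J \<longrightarrow> J = {0} \<or> J = UNIV)"

definition aut :: "('v \<Rightarrow> 'v) set" where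
  "aut = {g. Vector_Spaces.linear scl scl g \<and> bij g \<and>
             (\<forall>a n b. g (Y a n b) = Y (g a) n (g b)) \<and> g \<Omega> = \<Omega> \<and> g \<nu> = \<nu>}"

definition aut_group :: "('v \<Rightarrow> 'v) monoid" where
  "aut_group = \<lparr>carrier = aut, mult = (\<circ>), one = id\<rparr>"

text \<open>
  \<open>GL\<close> of a finite-dimensional subspace \<open>S\<close>, with the coarsest topology making all matrix
  coefficients continuous. Restrictions are taken to be \<^const>\<open>undefined\<close> outside \<open>S\<close>, so that each
  operator on \<open>S\<close> is represented exactly once.
\<close>

definition GL :: "'v set \<Rightarrow> ('v \<Rightarrow> 'v) set" where
  "GL S = {restrict g S | g. Vector_Spaces.linear scl scl g \<and> bij_betw g S S}"

definition GL_topology :: "'v set \<Rightarrow> ('v \<Rightarrow> 'v) topology" where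
  "GL_topology S = topology_generated_by
     {{h \<in> GL S. f (h a) \<in> U} | f a U. Vector_Spaces.linear scl (*) f \<and> a \<in> S \<and> open U}"

definition aut_topology :: "('v \<Rightarrow> 'v) topology" where
  "aut_topology = pullback_topology aut (\<lambda>g n. restrict g (W n))
     (product_topology (\<lambda>n. GL_topology (W n)) UNIV)"

definition antilinear_aut :: "('v \<Rightarrow> 'v) \<Rightarrow> bool" where
  "antilinear_aut \<theta> \<longleftrightarrow> Vector_Spaces.linear scl (\<lambda>c. scl (cnj c)) \<theta> \<and> bij \<theta> \<and>
     (\<forall>a n b. \<theta> (Y a n b) = Y (\<theta> a) n (\<theta> b)) \<and> \<theta> \<Omega> = \<Omega> \<and> \<theta> \<nu> = \<nu>"

definition scalar_product :: "('v \<Rightarrow> 'v \<Rightarrow> complex) \<Rightarrow> bool" where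
  "scalar_product ip \<longleftrightarrow> (\<forall>a. Vector_Spaces.linear scl (*) (ip a)) \<and>
     (\<forall>a b. ip b a = cnj (ip a b)) \<and> (\<forall>a. a \<noteq> 0 \<longrightarrow> Re (ip a a) > 0)"

definition weight_component :: "'v \<Rightarrow> int \<Rightarrow> 'v" where
  "weight_component a = (THE x. (\<forall>d. x d \<in> W d) \<and> finite {d. x d \<noteq> 0} \<and>
                                (\<Sum>d | x d \<noteq> 0. x d) = a)"

text \<open>
  The coefficient of \<open>z\<^sup>j\<close> in the Laurent polynomial \<open>e\<^bsup>zL\<^sub>1\<^esup> (-z\<^bsup>-2\<^esup>)\<^bsup>L\<^sub>0\<^esup> a\<close>, which equals
  \<open>\<Sum>\<^bsub>d,k\<^esub> (-1)\<^sup>d / k! z\<^bsup>k-2d\<^esup> L\<^sub>1\<^sup>k a\<^sub>d\<close>, \<open>a\<^sub>d\<close> being the weight components of \<open>a\<close>. The index set is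
  finite because \<open>L\<^sub>1\<close> lowers weights by 1 and the weights are bounded below.
\<close>

definition opposite_coeff :: "'v \<Rightarrow> int \<Rightarrow> 'v" where
  "opposite_coeff a j =
     (\<Sum>(k, d) | (L 1 ^^ k) (weight_component a d) \<noteq> 0 \<and> int k - 2 * d = j.
        ((-1) powi d / fact k) *s (L 1 ^^ k) (weight_component a d))"

text \<open>
  The identity \<open>(Y(\<theta> e\<^bsup>zL\<^sub>1\<^esup> (-z\<^bsup>-2\<^esup>)\<^bsup>L\<^sub>0\<^esup> a, z\<^bsup>-1\<^esup>) b | c) = (b | Y(a,z) c)\<close> of formal series, with
  \<open>\<theta>\<close> and \<open>(\<cdot>|\<cdot>)\<close> applied coefficientwise, at \<open>z\<^bsup>-m-1\<^esup>\<close>: the coefficient of \<open>z\<^bsup>-m-1-j\<^esup>\<close> in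
  \<open>Y(x, z\<^bsup>-1\<^esup>) = \<Sum>\<^bsub>n\<^esub> x\<^bsub>(n)\<^esub> z\<^bsup>n+1\<^esup>\<close> is \<open>x\<^bsub>(-m-2-j)\<^esub>\<close>.
\<close>

definition invariant_wrt :: "('v \<Rightarrow> 'v) \<Rightarrow> ('v \<Rightarrow> 'v \<Rightarrow> complex) \<Rightarrow> bool" where
  "invariant_wrt \<theta> ip \<longleftrightarrow> (\<forall>a b c m.
     (\<Sum>j | opposite_coeff a j \<noteq> 0. ip (Y (\<theta> (opposite_coeff a j)) (- m - 2 - j) b) c)
     = ip b (Y a m c))"

definition normalized_invariant_scalar_product :: "('v \<Rightarrow> 'v \<Rightarrow> complex) \<Rightarrow> bool" where
  "normalized_invariant_scalar_product ip \<longleftrightarrow>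
     scalar_product ip \<and> ip \<Omega> \<Omega> = 1 \<and>
     (\<exists>\<theta>. antilinear_aut \<theta> \<and> \<theta> \<circ> \<theta> = id \<and> invariant_wrt \<theta> ip)"

definition unitary_aut :: "('v \<Rightarrow> 'v \<Rightarrow> complex) \<Rightarrow> ('v \<Rightarrow> 'v) set" where
  "unitary_aut ip = {g \<in> aut. \<forall>a. ip (g a) (g a) = ip a a}"

end

locale unitary_voa = voa scl Y \<Omega> \<nu>
  for scl :: "complex \<Rightarrow> 'v::ab_group_add \<Rightarrow> 'v" (infixr \<open>*s\<close> 75)
    and Y :: "'v \<Rightarrow> int \<Rightarrow> 'v \<Rightarrow> 'v" and \<Omega> \<nu> :: 'v +
  fixes ip :: "'v \<Rightarrow> 'v \<Rightarrow> complex"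
  assumes ip_normalized_invariant: "normalized_invariant_scalar_product ip"

end

theory Submission
  imports Defs "HOL-Computational_Algebra.Fundamental_Theorem_Algebra"
begin

text \<open>
  The argument is the fixed point theorem of Cartan for a bounded group acting on a space of
  nonpositive curvature, carried out on the scalar products \<open>(h a | h b)\<close> with \<open>h\<close> an automorphism.
  Each of these is invariant and normalized, with PCT operator \<open>h\<^sup>-\<^sup>1 \<theta> h\<close>
  (\<open>transported_scalar_product\<close>), and \<open>G\<close> acts on them by \<open>h \<mapsto> h g\<close>; a fixed point is what is
  wanted.

  The geometry comes from simplicity. By Schur's lemma an invariant form is unique up to scaling
  (\<open>invariant_form_unique\<close>). Hence automorphisms preserve the bilinear form \<open>(\<theta> a | b)\<close>, and the
  adjoint \<open>\<theta> g\<^sup>-\<^sup>1 \<theta>\<close> of an automorphism \<open>g\<close> is again one. So \<open>g\<^sup>* g\<close> is a positive automorphism. Its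
  real powers are automorphisms too, because modes multiply eigenvalues (\<open>positive_power_aut\<close>).
  Any two forms are therefore joined by a geodesic, and they have a midpoint
  (\<open>relative_polar_part\<close>).

  The Lie group structure gives local compactness: there are finitely many weight spaces such that
  automorphisms close to the identity on them are bounded on every weight space
  (\<open>locally_compact_uniform_bound\<close>). Applied to powers of a positive automorphism \<open>S\<close>, this says
  that \<open>S\<close> is close to the identity everywhere as soon as it is close enough to it on these
  weight spaces (\<open>selfadjoint_aut_contraction\<close>). This takes the place of completeness of the
  symmetric space.

  Let \<open>F h\<close> be the supremum over \<open>g \<in> G\<close> of the trace of \<open>(h g)\<^sup>* (h g)\<close> on these weight spaces. It is
  finite since \<open>G\<close> is compact, it does not increase under \<open>h \<mapsto> h g\<close>, and it is uniformly convex
  along geodesics. Two near-minimizers of \<open>F\<close> thus define nearly the same form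
  (\<open>near_minimizers_close\<close>), so the forms of a minimizing sequence \<open>h\<^sub>k\<close> converge. The limit is
  \<open>(a | T b)\<close> for a positive automorphism \<open>T\<close> (\<open>weak_limit_selfadjoint_aut\<close>), that is,
  \<open>(h a | h b)\<close> with \<open>h\<close> the square root of \<open>T\<close>. It is fixed by \<open>G\<close>, since \<open>h\<^sub>k g\<close> is minimizing along
  with \<open>h\<^sub>k\<close>. The supremum over \<open>G\<close> plays the part of averaging against Haar measure.
\<close>

no_notation vector_scalar_mult (infixl "*s" 70)

section \<open>Operators annihilated by a polynomial\<close>

locale complex_vector_space = vector_space scl
  for scl :: "complex \<Rightarrow> 'v::ab_group_add \<Rightarrow> 'v" (infixr \<open>*s\<close> 75)
begin

abbreviation linop :: "('v \<Rightarrow> 'v) \<Rightarrow> bool" where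
  "linop \<equiv> Vector_Spaces.linear scl scl"

lemma linop_iff:
  "linop T \<longleftrightarrow> (\<forall>x y. T (x + y) = T x + T y) \<and> (\<forall>c x. T (c *s x) = c *s T x)"
  using vector_space_axioms by (simp add: Vector_Spaces.linear_iff)

lemma linop_add: "linop T \<Longrightarrow> T (x + y) = T x + T y"
  and linop_scale: "linop T \<Longrightarrow> T (c *s x) = c *s T x"
  by (simp_all add: linop_iff)

lemma linop_0: "linop T \<Longrightarrow> T 0 = 0"
  using linop_scale[of T 0 0] by simp

lemma linop_minus: "linop T \<Longrightarrow> T (- x) = - T x"
  using linop_scale[of T "-1" x] by simp

lemma linop_diff: "linop T \<Longrightarrow> T (x - y) = T x - T y"
  using linop_add[of T x "- y"] by (simp add: linop_minus)

lemma linop_sum: "linop T \<Longrightarrow> T (sum f A) = (\<Sum>a\<in>A. T (f a))"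
  by (induction A rule: infinite_finite_induct) (simp_all add: linop_0 linop_add)

lemma linop_comp: "linop S \<Longrightarrow> linop T \<Longrightarrow> linop (\<lambda>x. S (T x))"
  by (simp add: linop_iff)

lemma linop_funpow: "linop T \<Longrightarrow> linop (T ^^ n)"
  by (induction n) (simp_all add: linop_iff)

lemma linop_eq_on_span:
  assumes "linop S" "linop T" "\<And>x. x \<in> B \<Longrightarrow> S x = T x" "x \<in> span B"
  shows "S x = T x"
  using assms(4)
  by (induction rule: span_induct_alt) (use assms in \<open>simp_all add: linop_0 linop_add linop_scale\<close>)

lemma subspace_eigenspace: "linop T \<Longrightarrow> subspace {x. T x = c *s x}"
  by (auto simp: subspace_def linop_0 linop_add linop_scale scale_right_distrib scale_left_commute)

text \<open>
  The vectors \<open>v, T v, \<dots>, T\<^sup>n v\<close> with \<open>n\<close> the cardinality of \<open>B\<close> either repeat or are too many to be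
  independent.
\<close>

lemma krylov_dependence:
  assumes B: "finite B" "\<And>k. (T ^^ k) v \<in> span B"
  obtains p :: "complex poly" where "p \<noteq> 0" "(\<Sum>i\<le>degree p. coeff p i *s (T ^^ i) v) = 0"
proof -
  define n where "n = card B"
  have "\<exists>c. (\<exists>i\<le>n. c i \<noteq> 0) \<and> (\<Sum>i\<le>n. c i *s (T ^^ i) v) = 0"
  proof (cases "inj_on (\<lambda>i. (T ^^ i) v) {..n}")
    case True
    let ?A = "(\<lambda>i. (T ^^ i) v) ` {..n}"
    have "card ?A = Suc n" using True by (simp add: card_image)
    then have "dependent ?A"
      using independent_span_bound[OF B(1), of ?A] B(2) unfolding n_def by force
    then obtain u where u: "\<exists>w\<in>?A. u w \<noteq> 0" "(\<Sum>w\<in>?A. u w *s w) = 0"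
      by (subst (asm) dependent_finite) auto
    then show ?thesis
      using True by (intro exI[of _ "\<lambda>i. u ((T ^^ i) v)"]) (auto simp: sum.reindex)
  next
    case False
    then obtain i j where ij: "i \<le> n" "j \<le> n" "i \<noteq> j" "(T ^^ i) v = (T ^^ j) v"
      by (auto simp: inj_on_def)
    let ?c = "\<lambda>k. if k = i then 1 else if k = j then - 1 else 0 :: complex"
    have "(\<Sum>k\<le>n. ?c k *s (T ^^ k) v)
        = (\<Sum>k\<le>n. (if k = i then (T ^^ i) v else 0) - (if k = j then (T ^^ j) v else 0))"
      using ij(3) by (intro sum.cong) auto
    also have "\<dots> = 0" using ij by (simp add: sum_subtractf)
    finally show ?thesis using ij(1) by (intro exI[of _ ?c]) auto
  qed
  then obtain c where c: "\<exists>i\<le>n. c i \<noteq> 0" "(\<Sum>i\<le>n. c i *s (T ^^ i) v) = 0" by blast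
  define p where "p = (\<Sum>i\<le>n. monom (c i) i)"
  have coeff_p: "coeff p i = (if i \<le> n then c i else 0)" for i
    by (simp add: p_def coeff_sum)
  have deg: "degree p \<le> n" by (rule degree_le) (simp add: coeff_p)
  have "(\<Sum>i\<le>degree p. coeff p i *s (T ^^ i) v) = (\<Sum>i\<le>n. coeff p i *s (T ^^ i) v)"
    using deg by (intro sum.mono_neutral_left) (auto simp: coeff_eq_0)
  also have "\<dots> = 0" using c(2) by (simp add: coeff_p)
  finally show ?thesis using that[of p] c(1) coeff_p by (metis coeff_0)
qed

lemma poly_annihilator_splits:
  assumes T: "linop T"
  shows "p \<noteq> 0 \<Longrightarrow> (\<Sum>i\<le>degree p. coeff p i *s (T ^^ i) v) = 0
    \<Longrightarrow> \<exists>ls. fold (\<lambda>l x. T x - l *s x) ls v = 0"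
proof (induction "degree p" arbitrary: p v)
  case 0
  then have "coeff p 0 *s v = 0" "coeff p 0 \<noteq> 0"
    by (auto simp: leading_coeff_0_iff[symmetric] simp del: leading_coeff_0_iff)
  then show ?case by (intro exI[of _ "[]"]) simp
next
  case (Suc d)
  have "\<not> constant (poly p)" using Suc.hyps(2) by (simp add: constant_degree)
  then obtain z where "poly p z = 0" using fundamental_theorem_of_algebra by blast
  then obtain q where pq: "p = [:- z, 1:] * q" by (auto simp: poly_eq_0_iff_dvd dvd_def)
  have q0: "q \<noteq> 0" using pq Suc.prems(1) by auto
  then have deg: "degree p = Suc (degree q)" unfolding pq by (subst degree_mult_eq) auto
  have cp: "coeff p i = (case i of 0 \<Rightarrow> 0 | Suc k \<Rightarrow> coeff q k) - z * coeff q i" for i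
    by (cases i) (simp_all add: pq)
  let ?u = "T v - z *s v"
  have pw: "(T ^^ i) ?u = (T ^^ Suc i) v - z *s (T ^^ i) v" for i
    by (simp only: linop_diff[OF linop_funpow[OF T]] linop_scale[OF linop_funpow[OF T]]
        funpow_Suc_right o_apply)
  have "(\<Sum>i\<le>degree q. coeff q i *s (T ^^ i) ?u)
     = (\<Sum>i\<le>degree q. coeff q i *s (T ^^ Suc i) v) - (\<Sum>i\<le>degree q. (z * coeff q i) *s (T ^^ i) v)"
    unfolding pw by (simp add: scale_right_diff_distrib sum_subtractf mult.commute del: funpow.simps)
  also have "(\<Sum>i\<le>degree q. (z * coeff q i) *s (T ^^ i) v)
     = (\<Sum>i\<le>degree p. (z * coeff q i) *s (T ^^ i) v)"
    by (simp add: deg coeff_eq_0)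
  also have "(\<Sum>i\<le>degree q. coeff q i *s (T ^^ Suc i) v)
     = (\<Sum>i\<le>degree p. (case i of 0 \<Rightarrow> 0 | Suc k \<Rightarrow> coeff q k) *s (T ^^ i) v)"
    unfolding deg by (subst sum.atMost_Suc_shift) simp
  finally have "(\<Sum>i\<le>degree q. coeff q i *s (T ^^ i) ?u) = (\<Sum>i\<le>degree p. coeff p i *s (T ^^ i) v)"
    by (simp add: cp scale_left_diff_distrib sum_subtractf)
  with Suc obtain ls where "fold (\<lambda>l x. T x - l *s x) ls ?u = 0"
    using deg q0 by (metis Suc_inject)
  then show ?case by (intro exI[of _ "z # ls"]) simp
qed

lemma annihilating_factors:
  assumes "linop T" "finite B" "\<And>k. (T ^^ k) v \<in> span B"
  shows "\<exists>ls. fold (\<lambda>l x. T x - l *s x) ls v = 0"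
  using krylov_dependence[OF assms(2,3)] poly_annihilator_splits[OF assms(1)] by metis

lemma eigenvector_exists:
  assumes "linop T" "finite B" "\<And>k. (T ^^ k) v \<in> span B" "v \<noteq> 0"
  obtains l x where "x \<noteq> 0" "T x = l *s x"
proof -
  obtain ls where "fold (\<lambda>l x. T x - l *s x) ls v = 0"
    using annihilating_factors[OF assms(1-3)] by blast
  then have "\<exists>l x. x \<noteq> 0 \<and> T x = l *s x"
    using assms(4)
  proof (induction ls arbitrary: v)
    case (Cons l ls)
    show ?case
    proof (cases "T v - l *s v = 0")
      case True
      then show ?thesis using Cons.prems(2) by auto
    next
      case False
      then show ?thesis using Cons.IH[of "T v - l *s v"] Cons.prems(1) by auto
    qed
  qed simp
  then show ?thesis using that by blast
qed

end


section \<open>Inner products and positive operators\<close>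

locale complex_inner_product_space = complex_vector_space scl
  for scl :: "complex \<Rightarrow> 'v::ab_group_add \<Rightarrow> 'v" (infixr \<open>*s\<close> 75) +
  fixes ip :: "'v \<Rightarrow> 'v \<Rightarrow> complex"
  assumes ip_linear: "Vector_Spaces.linear scl (*) (ip a)"
    and ip_cnj: "ip b a = cnj (ip a b)"
    and ip_pos: "a \<noteq> 0 \<Longrightarrow> Re (ip a a) > 0"
begin

lemma ip_add_right: "ip a (b + c) = ip a b + ip a c"
  and ip_scale_right: "ip a (k *s b) = k * ip a b"
  using ip_linear[of a] by (auto simp: Vector_Spaces.linear_iff)

lemma ip_add_left: "ip (a + b) c = ip a c + ip b c"
  by (metis complex_cnj_add ip_add_right ip_cnj)

lemma ip_scale_left: "ip (k *s a) b = cnj k * ip a b"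
  by (metis complex_cnj_mult ip_scale_right ip_cnj)

lemma ip_0_right [simp]: "ip a 0 = 0"
  using ip_scale_right[of a 0 0] by simp

lemma ip_0_left [simp]: "ip 0 a = 0"
  using ip_scale_left[of 0 0 a] by simp

lemma ip_minus_right: "ip a (- b) = - ip a b"
  using ip_scale_right[of a "-1" b] by simp

lemma ip_minus_left: "ip (- a) b = - ip a b"
  using ip_scale_left[of "-1" a b] by simp

lemma ip_diff_right: "ip a (b - c) = ip a b - ip a c"
  using ip_add_right[of a b "- c"] by (simp add: ip_minus_right)

lemma ip_diff_left: "ip (a - b) c = ip a c - ip b c"
  using ip_add_left[of a "- b" c] by (simp add: ip_minus_left)

lemma ip_sum_right: "ip a (sum f A) = (\<Sum>i\<in>A. ip a (f i))"
  by (induction A rule: infinite_finite_induct) (simp_all add: ip_add_right)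

lemma ip_sum_left: "ip (sum f A) a = (\<Sum>i\<in>A. ip (f i) a)"
  by (induction A rule: infinite_finite_induct) (simp_all add: ip_add_left)

lemmas ip_bilinear = ip_add_right ip_add_left ip_diff_right ip_diff_left ip_scale_right ip_scale_left

definition nrm2 :: "'v \<Rightarrow> real" where "nrm2 x = Re (ip x x)"

definition nrm :: "'v \<Rightarrow> real" where "nrm x = sqrt (nrm2 x)"

lemma ip_self: "ip x x = of_real (nrm2 x)"
proof -
  have "Im (ip x x) = - Im (ip x x)"
    using arg_cong[OF ip_cnj[of x x], of Im] by simp
  then show ?thesis by (simp add: nrm2_def complex_eq_iff)
qed

lemma nrm2_pos: "x \<noteq> 0 \<Longrightarrow> 0 < nrm2 x"
  by (simp add: nrm2_def ip_pos)

lemma nrm2_0 [simp]: "nrm2 0 = 0" by (simp add: nrm2_def)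

lemma nrm2_nonneg [simp]: "0 \<le> nrm2 x"
  using nrm2_pos[of x] by (cases "x = 0") auto

lemma nrm2_eq_0_iff [simp]: "nrm2 x = 0 \<longleftrightarrow> x = 0"
  by (metis less_irrefl nrm2_0 nrm2_pos)

lemma nrm_nonneg [simp]: "0 \<le> nrm x" by (simp add: nrm_def)

lemma nrm_0 [simp]: "nrm 0 = 0" by (simp add: nrm_def)

lemma nrm_eq_0_iff [simp]: "nrm x = 0 \<longleftrightarrow> x = 0" by (simp add: nrm_def)

lemma nrm_power2: "(nrm x)\<^sup>2 = nrm2 x" by (simp add: nrm_def)

lemma ip_eqI: "(\<And>a. ip a x = ip a y) \<Longrightarrow> x = y"
  using nrm2_eq_0_iff[of "x - y"] by (simp add: nrm2_def ip_diff_right)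

lemma nrm2_scale: "nrm2 (c *s x) = (cmod c)\<^sup>2 * nrm2 x"
proof -
  have "complex_of_real (nrm2 (c *s x)) = (c * cnj c) * of_real (nrm2 x)"
    by (simp only: ip_self[symmetric] ip_bilinear mult_ac)
  also have "\<dots> = of_real ((cmod c)\<^sup>2 * nrm2 x)" by (simp add: complex_norm_square[symmetric])
  finally show ?thesis using of_real_eq_iff by blast
qed

lemma nrm_scale: "nrm (c *s x) = cmod c * nrm x"
  by (simp add: nrm_def nrm2_scale real_sqrt_mult)

lemma nrm2_add: "nrm2 (x + y) = nrm2 x + nrm2 y + 2 * Re (ip x y)"
proof -
  have "Re (ip y x) = Re (ip x y)" using arg_cong[OF ip_cnj[of y x], of Re] by simp
  then show ?thesis by (simp add: nrm2_def ip_bilinear)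
qed

lemma nrm2_diff: "nrm2 (x - y) = nrm2 x + nrm2 y - 2 * Re (ip x y)"
proof -
  have "Re (ip y x) = Re (ip x y)" using arg_cong[OF ip_cnj[of y x], of Re] by simp
  then show ?thesis by (simp add: nrm2_def ip_bilinear)
qed

lemma cauchy_schwarz: "cmod (ip x y) \<le> nrm x * nrm y"
proof (cases "y = 0")
  case False
  then have pos: "nrm2 y > 0" by (rule nrm2_pos)
  define c where "c = ip y x / of_real (nrm2 y)"
  have cip: "c * ip x y = of_real ((cmod (ip x y))\<^sup>2 / nrm2 y)"
    unfolding c_def using complex_norm_square[of "ip x y"] by (subst ip_cnj) (simp add: mult.commute)
  have c2: "(cmod c)\<^sup>2 * nrm2 y = (cmod (ip x y))\<^sup>2 / nrm2 y"
    using pos unfolding c_def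
    by (subst ip_cnj) (simp add: norm_divide power_divide power2_eq_square)
  have "0 \<le> nrm2 (x - c *s y)" by simp
  also have "\<dots> = nrm2 x - (cmod (ip x y))\<^sup>2 / nrm2 y"
    by (simp add: nrm2_diff nrm2_scale c2 ip_scale_right cip)
  finally have "(cmod (ip x y))\<^sup>2 \<le> nrm2 x * nrm2 y"
    using pos by (simp add: field_simps)
  then have "(cmod (ip x y))\<^sup>2 \<le> (nrm x * nrm y)\<^sup>2"
    by (simp add: power_mult_distrib nrm_power2)
  then show ?thesis by (rule power2_le_imp_le) simp
qed simp

lemma nrm_triangle: "nrm (x + y) \<le> nrm x + nrm y"
proof (rule power2_le_imp_le)
  have "Re (ip x y) \<le> nrm x * nrm y"
    using cauchy_schwarz[of x y] complex_Re_le_cmod order_trans by blast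
  then show "(nrm (x + y))\<^sup>2 \<le> (nrm x + nrm y)\<^sup>2"
    by (simp add: power2_sum nrm_power2 nrm2_add)
qed simp

lemma nrm_sum: "nrm (sum f A) \<le> (\<Sum>a\<in>A. nrm (f a))"
proof (induction A rule: infinite_finite_induct)
  case (insert x F)
  then show ?case using nrm_triangle[of "f x" "sum f F"] by simp
qed simp_all

definition orthonormal :: "'v set \<Rightarrow> bool" where
  "orthonormal E \<longleftrightarrow> (\<forall>e\<in>E. \<forall>e'\<in>E. ip e e' = (if e = e' then 1 else 0))"

lemma gram_schmidt:
  "finite B \<Longrightarrow> \<exists>E. finite E \<and> orthonormal E \<and> span E = span B"
proof (induction B rule: finite_induct)
  case empty
  then show ?case by (intro exI[of _ "{}"]) (simp add: orthonormal_def)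
next
  case (insert b B)
  then obtain E where E: "finite E" "orthonormal E" "span E = span B" by blast
  define p where "p = (\<Sum>e\<in>E. ip e b *s e)"
  have p: "p \<in> span E" unfolding p_def by (intro span_sum span_scale span_base)
  define d where "d = b - p"
  have orth: "ip e d = 0" if "e \<in> E" for e
  proof -
    have "ip e p = (\<Sum>e'\<in>E. if e = e' then ip e' b else 0)"
      unfolding p_def ip_sum_right ip_scale_right
      using E(2) that by (intro sum.cong) (auto simp: orthonormal_def)
    then show ?thesis using that E(1) by (simp add: d_def ip_diff_right)
  qed
  show ?case
  proof (cases "d = 0")
    case True
    then have "b \<in> span B" using p E(3) by (simp add: d_def)
    then show ?thesis using E by (intro exI[of _ E]) (simp add: span_redundant)
  next
    case False
    then have pos: "nrm d > 0" using nrm_nonneg[of d] nrm_eq_0_iff[of d] by linarith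
    define u where "u = of_real (1 / nrm d) *s d"
    have uu: "ip u u = 1"
    proof -
      have "nrm u = 1" using pos False by (simp add: u_def nrm_scale norm_divide)
      then show ?thesis by (simp add: ip_self nrm_power2[symmetric])
    qed
    have ue: "ip e u = 0" "ip u e = 0" if "e \<in> E" for e
      using orth[OF that] ip_cnj[of e u] by (simp_all add: u_def ip_scale_right)
    have "orthonormal (insert u E)"
      using E(2) uu ue by (auto simp: orthonormal_def)
    moreover have "span (insert u E) = span (insert b B)"
    proof -
      have db: "b = of_real (nrm d) *s u + p" using pos by (simp add: u_def d_def)
      have "b \<in> span (insert u E)"
        unfolding db using p span_mono[of E "insert u E"]
        by (intro span_add span_scale) (auto intro: span_base)
      moreover have "u \<in> span (insert b B)"
        unfolding u_def d_def using p span_mono[of B "insert b B"] E(3)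
        by (intro span_scale span_diff) (auto intro: span_base)
      moreover have "span B \<subseteq> span (insert u E)" "span E \<subseteq> span (insert b B)"
        using E(3) span_mono[of E "insert u E"] span_mono[of B "insert b B"] by blast+
      ultimately show ?thesis
        by (intro equalityI span_minimal subspace_span) (auto intro: span_base)
    qed
    ultimately show ?thesis using E(1) by (intro exI[of _ "insert u E"]) simp
  qed
qed

lemma orthonormal_basis_exists:
  assumes "subspace S" "S \<subseteq> span B" "finite B"
  obtains E where "finite E" "orthonormal E" "span E = S"
proof -
  obtain B' where B': "B' \<subseteq> S" "independent B'" "S \<subseteq> span B'"
    using basis_exists[of S] by metis
  have "finite B'" using independent_span_bound[OF assms(3) B'(2)] B'(1) assms(2) by blast
  moreover have "span B' = S" using B' assms(1) by (simp add: span_minimal subset_antisym)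
  ultimately show ?thesis using gram_schmidt[of B'] that by metis
qed

lemma orthonormal_expansion:
  assumes E: "finite E" "orthonormal E" and x: "x \<in> span E"
  shows "x = (\<Sum>e\<in>E. ip e x *s e)"
  using x
proof (induction rule: span_induct_alt)
  case (step c b y)
  have "(\<Sum>e\<in>E. ip e b *s e) = (\<Sum>e\<in>E. if e = b then b else 0)"
    using E(2) step(1) by (intro sum.cong) (auto simp: orthonormal_def)
  then have "(\<Sum>e\<in>E. ip e b *s e) = b" using E(1) step(1) by simp
  then have "(\<Sum>e\<in>E. ip e (c *s b + y) *s e) = c *s b + (\<Sum>e\<in>E. ip e y *s e)"
    by (simp add: ip_add_right ip_scale_right scale_left_distrib sum.distrib
        scale_sum_right[symmetric] flip: scale_scale)
  then show ?case using step(2) by simp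
qed simp

lemma orthonormal_nrm: "orthonormal E \<Longrightarrow> e \<in> E \<Longrightarrow> nrm e = 1"
  by (simp add: orthonormal_def nrm_def nrm2_def)

lemma nrm_le_sum_basis:
  assumes E: "finite E" "orthonormal E" and x: "x \<in> span E" and T: "linop T"
  shows "nrm (T x) \<le> (\<Sum>e\<in>E. nrm (T e)) * nrm x"
proof -
  have "T x = (\<Sum>e\<in>E. ip e x *s T e)"
    by (subst orthonormal_expansion[OF E x]) (simp add: linop_sum[OF T] linop_scale[OF T])
  then have "nrm (T x) \<le> (\<Sum>e\<in>E. nrm (ip e x *s T e))" by (simp add: nrm_sum)
  also have "\<dots> \<le> (\<Sum>e\<in>E. nrm x * nrm (T e))"
    using cauchy_schwarz[of _ x] orthonormal_nrm[OF E(2)]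
    by (intro sum_mono) (simp add: nrm_scale mult_right_mono, metis mult_1 mult_right_mono nrm_nonneg)
  finally show ?thesis by (simp add: sum_distrib_left mult.commute)
qed

definition selfadjoint :: "('v \<Rightarrow> 'v) \<Rightarrow> bool" where
  "selfadjoint T \<longleftrightarrow> (\<forall>x y. ip (T x) y = ip x (T y))"

lemma eigenvectors_orthogonal:
  assumes "selfadjoint T" "T x = of_real m *s x" "T y = of_real k *s y" "m \<noteq> k"
  shows "ip x y = 0"
proof -
  have "of_real m * ip x y = of_real k * ip x y"
    using assms(1)[unfolded selfadjoint_def, rule_format, of x y] assms(2,3)
    by (simp add: ip_bilinear)
  then show ?thesis using assms(4) by simp
qed

text \<open>
  A factor \<open>T - l\<close> acts invertibly on the eigenspaces for eigenvalues other than \<open>l\<close>. Peeling off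
  one factor therefore leaves a vector killed by \<open>(T - l)\<^sup>2\<close>, which for self-adjoint \<open>T\<close> is already
  killed by \<open>T - l\<close>.
\<close>

lemma positive_in_span_eigenvectors:
  assumes T: "linop T" "selfadjoint T"
    and pos: "\<And>x. Re (ip x (T x)) \<ge> 0" and inj: "\<And>x. T x = 0 \<Longrightarrow> x = 0"
  shows "fold (\<lambda>l x. T x - l *s x) ls v = 0 \<Longrightarrow> v \<in> span {x. \<exists>m>0. T x = of_real m *s x}"
proof (induction ls arbitrary: v)
  case Nil
  then show ?case by (simp add: span_zero)
next
  case (Cons l ls)
  let ?E = "{x. \<exists>m>0. T x = of_real m *s x}"
  have "T v - l *s v \<in> span ?E" using Cons by simp
  then have "\<exists>w u. w \<in> span ?E \<and> T u = l *s u \<and> T v - l *s v = (T w - l *s w) + u"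
  proof (induction rule: span_induct_alt)
    case base
    then show ?case by (intro exI[of _ 0]) (simp add: span_zero linop_0[OF T(1)])
  next
    case (step c x y)
    then obtain m w u where m: "T x = of_real m *s x"
      and wu: "w \<in> span ?E" "T u = l *s u" "y = (T w - l *s w) + u" by auto
    show ?case
    proof (cases "l = of_real m")
      case True
      then show ?thesis using wu m
        by (intro exI[of _ w] exI[of _ "c *s x + u"])
          (simp add: linop_add[OF T(1)] linop_scale[OF T(1)] scale_right_distrib mult.commute)
    next
      case False
      let ?w = "(c / (of_real m - l)) *s x + w"
      have "T ?w - l *s ?w = (c / (of_real m - l)) *s (of_real m *s x - l *s x) + (T w - l *s w)"
        by (simp add: linop_add[OF T(1)] linop_scale[OF T(1)] m algebra_simps)
      also have "\<dots> = c *s x + (T w - l *s w)"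
        using False by (simp add: scale_left_diff_distrib[symmetric])
      finally show ?thesis
        using wu step(1) by (intro exI[of _ ?w] exI[of _ u]) (auto intro: span_add span_scale span_base)
    qed
  qed
  then obtain w u where wu: "w \<in> span ?E" "T u = l *s u" "T v - l *s v = (T w - l *s w) + u" by blast
  define x where "x = v - w"
  have Tx: "T x - l *s x = u"
    using wu(3) by (simp add: x_def linop_diff[OF T(1)] algebra_simps)
  have real: "\<exists>m>0. l = of_real m" if "y \<noteq> 0" "T y = l *s y" for y
  proof -
    have "ip y (T y) = cnj (ip y (T y))"
      using T(2) unfolding selfadjoint_def by (metis ip_cnj)
    then have "l = cnj l" using that nrm2_pos[of y] by (auto simp: ip_scale_right ip_self)
    then have "l = of_real (Re l)" by (simp add: complex_eq_iff)
    moreover have "Re l \<ge> 0"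
      using pos[of y] that nrm2_pos[of y] by (simp add: ip_scale_right ip_self zero_le_mult_iff)
    moreover have "l \<noteq> 0" using inj[of y] that by auto
    ultimately show ?thesis by (metis less_eq_real_def of_real_0)
  qed
  have "u = 0"
  proof (rule ccontr)
    assume "u \<noteq> 0"
    then obtain m where m: "l = of_real m" using real wu(2) by blast
    have "ip u u = ip (T x) u - ip (l *s x) u" by (simp add: Tx[symmetric] ip_diff_left)
    also have "\<dots> = ip x (T u) - l * ip x u"
      using T(2) by (simp add: selfadjoint_def ip_scale_left m)
    also have "\<dots> = 0" by (simp add: wu(2) ip_scale_right)
    finally show False using \<open>u \<noteq> 0\<close> by (simp add: ip_self)
  qed
  then have "T x = l *s x" using Tx by simp
  then have "x \<in> span ?E" using real[of x] by (cases "x = 0") (auto intro: span_base span_zero)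
  then show ?case using span_add[OF _ wu(1), of x] by (simp add: x_def)
qed

text \<open>
  The power \<open>T\<^sup>t\<close> of the functional calculus. This is a relation because it determines \<open>P\<close> only on
  the span of the eigenvectors with positive eigenvalues; where uniqueness matters they span the
  whole space.
\<close>

definition is_positive_power :: "('v \<Rightarrow> 'v) \<Rightarrow> real \<Rightarrow> ('v \<Rightarrow> 'v) \<Rightarrow> bool" where
  "is_positive_power T t P \<longleftrightarrow> linop P \<and> (\<forall>m>0. \<forall>x. T x = of_real m *s x \<longrightarrow> P x = of_real (m powr t) *s x)"

text \<open>
  The operator is prescribed on a basis of eigenvectors. An arbitrary eigenvector for \<open>m\<close> then only
  involves basis vectors for \<open>m\<close>, because eigenspaces are orthogonal.
\<close>

lemma positive_power_exists:
  assumes T: "linop T" "selfadjoint T"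
  shows "\<exists>P. is_positive_power T t P"
proof -
  let ?E = "{x. \<exists>m>0. T x = of_real m *s x}"
  obtain B where B: "B \<subseteq> ?E" "independent B" "?E \<subseteq> span B"
    using maximal_independent_subset by blast
  then obtain m where m: "\<And>b. b \<in> B \<Longrightarrow> m b > 0 \<and> T b = of_real (m b) *s b"
    by (simp add: subset_iff) metis
  interpret pair: vector_space_pair scl scl
    using vector_space_axioms by (simp add: vector_space_pair_def)
  obtain P where P: "linop P" "\<And>b. b \<in> B \<Longrightarrow> P b = of_real (m b powr t) *s b"
    using pair.linear_independent_extend[OF B(2), of "\<lambda>b. of_real (m b powr t) *s b"] by blast
  have "P x = of_real (\<mu> powr t) *s x" if \<mu>: "\<mu> > 0" "T x = of_real \<mu> *s x" for \<mu> x
  proof -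
    let ?B1 = "{b \<in> B. m b = \<mu>}" and ?B2 = "{b \<in> B. m b \<noteq> \<mu>}"
    have "?B1 \<union> ?B2 = B" by auto
    moreover have "x \<in> span B" using \<mu> B(3) by blast
    ultimately obtain y z where yz: "x = y + z" "y \<in> span ?B1" "z \<in> span ?B2"
      using span_Un[of ?B1 ?B2] by auto
    have Ty: "T y = of_real \<mu> *s y" and Py: "P y = of_real (\<mu> powr t) *s y"
      using linop_eq_on_span[OF T(1) linear_scale_self _ yz(2)]
        linop_eq_on_span[OF P(1) linear_scale_self _ yz(2)] m P(2) by auto
    have Tz: "T z = of_real \<mu> *s z"
      using \<mu>(2) Ty yz(1) by (simp add: linop_add[OF T(1)] scale_right_distrib)
    have "ip z w = 0" if "w \<in> span ?B2" for w
      using that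
    proof (induction rule: span_induct_alt)
      case (step c b w)
      then have "ip z b = 0" using eigenvectors_orthogonal[OF T(2) Tz] m by auto
      then show ?case using step by (simp add: ip_bilinear)
    qed simp
    then have "z = 0" using yz(3) by (metis ip_self nrm2_eq_0_iff of_real_eq_0_iff)
    then show ?thesis using Py yz(1) by simp
  qed
  then show ?thesis using P(1) unfolding is_positive_power_def by blast
qed

lemma positive_power_linop: "is_positive_power T t P \<Longrightarrow> linop P"
  by (simp add: is_positive_power_def)

lemma positive_power_eigen:
  "is_positive_power T t P \<Longrightarrow> m > 0 \<Longrightarrow> T x = of_real m *s x \<Longrightarrow> P x = of_real (m powr t) *s x"
  by (simp add: is_positive_power_def)

lemma positive_power_1: "linop T \<Longrightarrow> is_positive_power T 1 T"
  by (simp add: is_positive_power_def)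

lemma positive_power_0: "is_positive_power T 0 (\<lambda>x. x)"
  by (simp add: is_positive_power_def linear_ident)

lemma positive_power_add:
  assumes span: "span {x. \<exists>m>0. T x = of_real m *s x} = UNIV"
    and P: "is_positive_power T t P" and Q: "is_positive_power T u Q"
    and R: "is_positive_power T (t + u) R"
  shows "P (Q x) = R x"
proof (rule linop_eq_on_span[of "\<lambda>x. P (Q x)"])
  show "linop (\<lambda>x. P (Q x))" "linop R"
    using P Q R by (auto intro: positive_power_linop linop_comp)
  show "x \<in> span {x. \<exists>m>0. T x = of_real m *s x}" using span by simp
  fix y assume "y \<in> {x. \<exists>m>0. T x = of_real m *s x}"
  then obtain m where "m > 0" "T y = of_real m *s y" by blast
  then show "P (Q y) = R y"
    using P Q R by (simp add: positive_power_eigen linop_scale[OF positive_power_linop]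
        powr_add mult.commute)
qed

lemma positive_power_selfadjoint:
  assumes span: "span {x. \<exists>m>0. T x = of_real m *s x} = UNIV"
    and T: "selfadjoint T" and P: "is_positive_power T t P"
  shows "selfadjoint P"
  unfolding selfadjoint_def
proof (intro allI)
  fix x y
  let ?E = "{x. \<exists>m>0. T x = of_real m *s x}"
  note lin = positive_power_linop[OF P]
  have eigen: "ip (P a) b = ip a (P b)" if ab: "a \<in> ?E" "b \<in> ?E" for a b
  proof -
    obtain m k where mk: "m > 0" "T a = of_real m *s a" "k > 0" "T b = of_real k *s b"
      using ab by blast
    then have "P a = of_real (m powr t) *s a" "P b = of_real (k powr t) *s b"
      using positive_power_eigen[OF P] by auto
    then show ?thesis
      using eigenvectors_orthogonal[OF T mk(2,4)] by (cases "m = k") (simp_all add: ip_bilinear)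
  qed
  have left: "ip (P a) y = ip a (P y)" if "a \<in> ?E" for a
  proof -
    have "y \<in> span ?E" using span by simp
    then show ?thesis
      by (induction rule: span_induct_alt)
        (simp_all add: linop_0[OF lin] linop_add[OF lin] linop_scale[OF lin] ip_bilinear eigen[OF that])
  qed
  have "x \<in> span ?E" using span by simp
  then show "ip (P x) y = ip x (P y)"
    by (induction rule: span_induct_alt)
      (simp_all add: linop_0[OF lin] linop_add[OF lin] linop_scale[OF lin] ip_bilinear left)
qed

text \<open>
  The sequence \<open>k \<mapsto> nrm (S\<^sup>k x)\<close> is log-convex, by the Cauchy-Schwarz inequality for \<open>S\<^sup>k x\<close> and
  \<open>S\<^sup>k\<^sup>+\<^sup>2 x\<close>; so its first ratio is its smallest one. Bounds on a high power of \<open>S\<close> thereby give much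
  sharper bounds on \<open>S\<close>.
\<close>

lemma selfadjoint_log_convex:
  assumes S: "selfadjoint S"
  shows "nrm (S x) * nrm ((S ^^ k) x) \<le> nrm x * nrm ((S ^^ Suc k) x)"
proof (induction k)
  case (Suc k)
  define u where "u = (S ^^ k) x"
  have a: "nrm (S u) * nrm (S u) \<le> nrm u * nrm (S (S u))"
  proof -
    have "nrm (S u) * nrm (S u) = cmod (ip (S u) (S u))"
      by (simp add: ip_self nrm_power2[symmetric] power2_eq_square norm_mult)
    also have "\<dots> = cmod (ip u (S (S u)))" using S by (simp add: selfadjoint_def)
    finally show ?thesis using cauchy_schwarz by simp
  qed
  have IH: "nrm (S x) * nrm u \<le> nrm x * nrm (S u)" using Suc by (simp add: u_def)
  have "nrm (S u) * (nrm (S x) * nrm (S u)) \<le> nrm (S u) * (nrm x * nrm (S (S u)))"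
  proof -
    have "nrm (S x) * (nrm (S u) * nrm (S u)) \<le> nrm (S x) * (nrm u * nrm (S (S u)))"
      using a by (rule mult_left_mono) simp
    also have "\<dots> = (nrm (S x) * nrm u) * nrm (S (S u))" by (simp only: mult.assoc)
    also have "\<dots> \<le> (nrm x * nrm (S u)) * nrm (S (S u))" using IH by (rule mult_right_mono) simp
    finally show ?thesis by (simp only: mult_ac)
  qed
  then have "nrm (S u) = 0 \<or> nrm (S x) * nrm (S u) \<le> nrm x * nrm (S (S u))"
    using nrm_nonneg[of "S u"] by (metis less_eq_real_def mult_le_cancel_left_pos)
  then have "nrm (S x) * nrm (S u) \<le> nrm x * nrm (S (S u))"
    by (elim disjE) (simp_all del: nrm_eq_0_iff)
  then show ?case by (simp add: u_def)
qed (simp add: mult.commute)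

lemma selfadjoint_power_bound:
  assumes S: "selfadjoint S"
  shows "nrm (S x) ^ k * nrm x \<le> nrm x ^ k * nrm ((S ^^ k) x)"
proof (induction k)
  case (Suc k)
  have "nrm (S x) ^ Suc k * nrm x = nrm (S x) * (nrm (S x) ^ k * nrm x)" by simp
  also have "\<dots> \<le> nrm (S x) * (nrm x ^ k * nrm ((S ^^ k) x))"
    using Suc by (rule mult_left_mono) simp
  also have "\<dots> = nrm x ^ k * (nrm (S x) * nrm ((S ^^ k) x))" by (simp only: mult_ac)
  also have "\<dots> \<le> nrm x ^ k * (nrm x * nrm ((S ^^ Suc k) x))"
    using selfadjoint_log_convex[OF S] by (rule mult_left_mono) simp
  finally show ?case by (simp only: power_Suc2 mult_ac)
qed simp

lemma near_identity_power:
  assumes S: "linop S" and inv: "\<And>x. x \<in> X \<Longrightarrow> S x \<in> X" and X: "subspace X"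
    and near: "\<And>x. x \<in> X \<Longrightarrow> nrm (S x - x) \<le> \<eta> * nrm x" and x: "x \<in> X"
  shows "nrm ((S ^^ k) x - x) \<le> ((1 + \<eta>) ^ k - 1) * nrm x"
proof (induction k)
  case (Suc k)
  define u where "u = (S ^^ k) x"
  have uX: "u \<in> X" unfolding u_def by (induction k) (simp_all add: x inv)
  have SN: "nrm (S y) \<le> (1 + \<eta>) * nrm y" if "y \<in> X" for y
    using nrm_triangle[of "S y - y" y] near[OF that] by (simp add: algebra_simps)
  have "x = 0 \<or> 0 \<le> \<eta>"
    using order_trans[OF nrm_nonneg near[OF x]] nrm_nonneg[of x] by (auto simp: zero_le_mult_iff)
  have "nrm (S u - x) \<le> nrm (S (u - x)) + nrm (S x - x)"
    using nrm_triangle[of "S (u - x)" "S x - x"] by (simp add: linop_diff[OF S])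
  also have "\<dots> \<le> (1 + \<eta>) * nrm (u - x) + \<eta> * nrm x"
    using SN[of "u - x"] near[OF x] subspace_diff[OF X uX x] by simp
  also have "\<dots> \<le> (1 + \<eta>) * (((1 + \<eta>) ^ k - 1) * nrm x) + \<eta> * nrm x"
  proof (cases "x = 0")
    case True
    then have "u = 0" unfolding u_def by (simp add: linop_0[OF linop_funpow[OF S]])
    then show ?thesis using True by simp
  next
    case False
    then have "0 \<le> 1 + \<eta>" using \<open>x = 0 \<or> 0 \<le> \<eta>\<close> by simp
    then show ?thesis using Suc unfolding u_def by (simp add: mult_left_mono)
  qed
  also have "\<dots> = ((1 + \<eta>) ^ Suc k - 1) * nrm x" by (simp add: algebra_simps)
  finally show ?case by (simp add: u_def)
qed simp

end


section \<open>Weights and invariant forms\<close>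

sublocale voa \<subseteq> complex_vector_space scl ..

context voa
begin

lemma Y_linop: "linop (Y a n)" by (rule Y_linear_right)

lemma Y_linop_left: "linop (\<lambda>a. Y a n b)" by (rule Y_linear_left)

lemmas Y_simps =
  linop_0[OF Y_linop] linop_add[OF Y_linop] linop_scale[OF Y_linop] linop_diff[OF Y_linop]
  linop_sum[OF Y_linop] linop_0[OF Y_linop_left] linop_add[OF Y_linop_left]
  linop_scale[OF Y_linop_left] linop_sum[OF Y_linop_left]

lemma L_linop: "linop (L n)"
  unfolding virasoro_mode_def by (rule Y_linop)

lemma W_iff: "a \<in> W n \<longleftrightarrow> L 0 a = of_int n *s a"
  by (simp add: weight_space_def)

lemma subspace_W: "subspace (W n)"
  using subspace_eigenspace[OF L_linop] by (simp add: weight_space_def)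

lemma vacuum_W: "\<Omega> \<in> W 0"
  using creation(2)[of 1 \<nu>] by (simp add: W_iff virasoro_mode_def)

lemma conformal_vector_weight: "L 0 \<nu> = 2 *s \<nu>" and L1_conformal_vector: "L 1 \<nu> = 0"
proof -
  obtain cc :: complex where vir: "\<And>m n a. L m (L n a) - L n (L m a)
      = of_int (m - n) *s L (m + n) a + (if m + n = 0 then cc / 12 * of_int (m ^ 3 - m) else 0) *s a"
    using virasoro by blast
  have nu: "L (-2) \<Omega> = \<nu>" using creation(1)[of \<nu>] by (simp add: virasoro_mode_def)
  have L0: "L 0 \<Omega> = 0" "L 1 \<Omega> = 0"
    using creation(2)[of 1 \<nu>] creation(2)[of 2 \<nu>] by (simp_all add: virasoro_mode_def)
  show "L 0 \<nu> = 2 *s \<nu>" using vir[of 0 "-2" \<Omega>] by (simp add: nu L0 linop_0[OF L_linop])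
  show "L 1 \<nu> = 0"
    using vir[of 1 "-2" \<Omega>] by (simp add: nu L0 linop_0[OF L_linop] translation_vacuum)
qed

text \<open>
  Eigenvectors of \<open>L\<^sub>0\<close>: applying \<open>L\<^sub>0 - k\<close> removes one summand and rescales the others.
\<close>

lemma weight_independent:
  assumes "finite D" "\<And>d. d \<in> D \<Longrightarrow> y d \<in> W d" "(\<Sum>d\<in>D. y d) = 0"
  shows "\<forall>d\<in>D. y d = 0"
  using assms
proof (induction D arbitrary: y rule: finite_induct)
  case (insert k D)
  define z where "z d = of_int (d - k) *s y d" for d
  have zW: "z d \<in> W d" if "d \<in> D" for d
    unfolding z_def using insert.prems(1)[of d] that subspace_scale[OF subspace_W] by blast
  have "(\<Sum>d\<in>insert k D. z d) = L 0 (\<Sum>d\<in>insert k D. y d) - of_int k *s (\<Sum>d\<in>insert k D. y d)"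
    unfolding linop_sum[OF L_linop] scale_sum_right sum_subtractf[symmetric]
    using insert.prems(1) by (intro sum.cong) (simp_all add: z_def W_iff scale_left_diff_distrib)
  then have "(\<Sum>d\<in>D. z d) = 0"
    using insert.hyps insert.prems(2) by (simp add: z_def linop_0[OF L_linop])
  then have "\<forall>d\<in>D. z d = 0" using insert.IH[of z] zW by blast
  then have "\<forall>d\<in>D. y d = 0" using insert.hyps(2) by (auto simp: z_def)
  then show ?case using insert.prems(2) insert.hyps by simp
qed simp

lemma weight_decomposition_exists:
  "\<exists>x. (\<forall>d. x d \<in> W d) \<and> finite {d. x d \<noteq> 0} \<and> (\<Sum>d | x d \<noteq> 0. x d) = a"
proof -
  have "a \<in> span (\<Union>n. W n)" using weight_decomposition by simp
  then show ?thesis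
  proof (induction rule: span_induct_alt)
    case base
    then show ?case by (intro exI[of _ "\<lambda>_. 0"]) (simp add: subspace_0[OF subspace_W])
  next
    case (step c b y)
    then obtain n x where n: "b \<in> W n"
      and x: "\<forall>d. x d \<in> W d" "finite {d. x d \<noteq> 0}" "(\<Sum>d | x d \<noteq> 0. x d) = y" by blast
    define z where "z d = (if d = n then c *s b else 0) + x d" for d
    let ?D = "insert n {d. x d \<noteq> 0}"
    have fin: "finite ?D" using x(2) by simp
    have "\<forall>d. z d \<in> W d"
      using n x(1) by (auto simp: z_def subspace_0[OF subspace_W]
          intro!: subspace_add[OF subspace_W] subspace_scale[OF subspace_W])
    moreover have sub: "{d. z d \<noteq> 0} \<subseteq> ?D" by (auto simp: z_def)
    moreover have "(\<Sum>d | z d \<noteq> 0. z d) = c *s b + y"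
    proof -
      have "(\<Sum>d | z d \<noteq> 0. z d) = (\<Sum>d\<in>?D. z d)"
        using fin sub by (intro sum.mono_neutral_left) auto
      also have "\<dots> = c *s b + (\<Sum>d\<in>?D. x d)"
        using fin by (simp add: z_def sum.distrib)
      also have "(\<Sum>d\<in>?D. x d) = y"
        unfolding x(3)[symmetric] using fin by (intro sum.mono_neutral_right) auto
      finally show ?thesis .
    qed
    ultimately show ?case using finite_subset[OF sub fin] by (intro exI[of _ z] conjI)
  qed
qed

lemma weight_decomposition_unique:
  assumes x: "\<forall>d. x d \<in> W d" "finite {d. x d \<noteq> 0}" "(\<Sum>d | x d \<noteq> 0. x d) = a"
    and y: "\<forall>d. y d \<in> W d" "finite {d. y d \<noteq> 0}" "(\<Sum>d | y d \<noteq> 0. y d) = a"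
  shows "x = y"
proof -
  let ?D = "{d. x d \<noteq> 0} \<union> {d. y d \<noteq> 0}"
  have "sum x ?D = sum x {d. x d \<noteq> 0}" "sum y ?D = sum y {d. y d \<noteq> 0}"
    by (rule sum.mono_neutral_right; use x(2) y(2) in auto)+
  then have "(\<Sum>d\<in>?D. x d - y d) = 0" using x(3) y(3) by (simp add: sum_subtractf)
  then have "\<forall>d\<in>?D. x d - y d = 0"
  proof (rule weight_independent[rotated 2])
    show "finite ?D" using x(2) y(2) by (rule finite_UnI)
    show "x d - y d \<in> W d" for d
      by (rule subspace_diff[OF subspace_W x(1)[rule_format] y(1)[rule_format]])
  qed
  then have zero: "d \<in> ?D \<Longrightarrow> x d - y d = 0" for d by (rule bspec)
  have "x d = y d" for d
  proof (cases "d \<in> ?D")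
    case True
    from zero[OF this] show ?thesis by (simp only: right_minus_eq)
  qed simp
  then show ?thesis by (rule ext)
qed

lemma weight_component_props:
  "weight_component a d \<in> W d" "finite {d. weight_component a d \<noteq> 0}"
  "(\<Sum>d | weight_component a d \<noteq> 0. weight_component a d) = a"
proof -
  let ?P = "\<lambda>x. (\<forall>d. x d \<in> W d) \<and> finite {d. x d \<noteq> 0} \<and> (\<Sum>d | x d \<noteq> 0. x d) = a"
  obtain x where x: "?P x" using weight_decomposition_exists by blast
  have uniq: "x' = x" if "?P x'" for x'
    using that x by (elim conjE) (rule weight_decomposition_unique)
  have "weight_component a = x"
    unfolding weight_component_def[abs_def] by (rule the_equality[of ?P x, OF x uniq])
  then show "weight_component a d \<in> W d" "finite {d. weight_component a d \<noteq> 0}"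
    "(\<Sum>d | weight_component a d \<noteq> 0. weight_component a d) = a"
    using x by simp_all
qed

lemma weight_component_eq:
  assumes "\<forall>d. x d \<in> W d" "finite {d. x d \<noteq> 0}" "(\<Sum>d | x d \<noteq> 0. x d) = a"
  shows "weight_component a = x"
  by (rule weight_decomposition_unique[OF _ _ _ assms]) (simp_all add: weight_component_props)

text \<open>Stated for real scalars, so as to cover linear and antilinear maps at once.\<close>

lemma opposite_coeff_natural:
  assumes add: "\<And>x y. f (x + y) = f x + f y"
    and scale: "\<And>r x. f (complex_of_real r *s x) = complex_of_real r *s f x"
    and inj: "inj f"
    and L: "\<And>n x. f (L n x) = L n (f x)"
  shows "opposite_coeff (f a) j = f (opposite_coeff a j)"
proof -
  have f0: "f 0 = 0" using scale[of 0 0] by simp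
  have f0_iff: "f x = 0 \<longleftrightarrow> x = 0" for x using inj f0 by (metis injD)
  have fsum: "f (sum g A) = (\<Sum>a\<in>A. f (g a))" for g :: "nat \<times> int \<Rightarrow> 'v" and A
    by (induction A rule: infinite_finite_induct) (simp_all add: f0 add)
  have fsum_int: "f (sum g A) = (\<Sum>a\<in>A. f (g a))" for g :: "int \<Rightarrow> 'v" and A
    by (induction A rule: infinite_finite_induct) (simp_all add: f0 add)
  have fW: "f x \<in> W d" if "x \<in> W d" for x d
    using that scale[of "of_int d" x] by (simp add: W_iff L[symmetric])
  have wc: "weight_component (f a) = (\<lambda>d. f (weight_component a d))"
    using weight_component_props[of a]
    by (intro weight_component_eq) (auto simp: f0_iff fW fsum_int[symmetric])
  have Lk: "(L 1 ^^ k) (f x) = f ((L 1 ^^ k) x)" for k x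
    by (induction k) (simp_all add: L)
  have coeff: "((- 1) powi d / fact k) *s f x = f (((- 1) powi d / fact k) *s x)" for d k x
    using scale[of "(- 1) powi d / fact k" x] by (simp add: of_real_power_int)
  show ?thesis
    unfolding opposite_coeff_def wc Lk f0_iff coeff fsum by (simp add: case_prod_beta)
qed

lemma opposite_coeff_conformal_vector: "opposite_coeff \<nu> j = (if j = - 4 then \<nu> else 0)"
proof -
  have wc: "weight_component \<nu> = (\<lambda>d. if d = 2 then \<nu> else 0)"
    by (rule weight_component_eq)
      (auto simp: W_iff conformal_vector_weight subspace_0[OF subspace_W, unfolded W_iff] linop_0[OF L_linop])
  have Lk: "(L 1 ^^ k) (weight_component \<nu> d) = (if k = 0 \<and> d = 2 then \<nu> else 0)" for k d
  proof (cases k)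
    case (Suc i)
    then show ?thesis
      by (simp add: wc funpow_swap1 L1_conformal_vector linop_0[OF L_linop] linop_0[OF linop_funpow[OF L_linop]]
          del: funpow.simps add: funpow_Suc_right)
  qed (simp add: wc)
  have "{(k :: nat, d). (L 1 ^^ k) (weight_component \<nu> d) \<noteq> 0 \<and> int k - 2 * d = j}
      = (if \<nu> \<noteq> 0 \<and> j = - 4 then {(0, 2)} else {})"
    unfolding Lk by (auto split: if_splits)
  then show ?thesis unfolding opposite_coeff_def Lk by simp
qed

definition sesquilinear :: "('v \<Rightarrow> 'v \<Rightarrow> complex) \<Rightarrow> bool" where
  "sesquilinear f \<longleftrightarrow> (\<forall>a b c. f a (b + c) = f a b + f a c \<and> f (a + b) c = f a c + f b c) \<and>
     (\<forall>k a b. f a (k *s b) = k * f a b \<and> f (k *s a) b = cnj k * f a b)"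

lemma sesquilinearD:
  assumes "sesquilinear f"
  shows "f a (b + c) = f a b + f a c" "f (a + b) c = f a c + f b c"
    "f a (k *s b) = k * f a b" "f (k *s a) b = cnj k * f a b" "f 0 b = 0" "f a 0 = 0"
proof -
  show "f a (b + c) = f a b + f a c" "f (a + b) c = f a c + f b c"
    "f a (k *s b) = k * f a b" "f (k *s a) b = cnj k * f a b"
    using assms by (simp_all add: sesquilinear_def)
  have "f (0 *s 0) b = 0" "f a (0 *s 0) = 0"
    using assms unfolding sesquilinear_def by (metis complex_cnj_zero mult_zero_left)+
  then show "f 0 b = 0" "f a 0 = 0" by simp_all
qed

lemma sesquilinear_sum_left: "sesquilinear f \<Longrightarrow> f (sum g A) b = (\<Sum>i\<in>A. f (g i) b)"
  by (induction A rule: infinite_finite_induct) (simp_all add: sesquilinearD)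

text \<open>
  Since \<open>\<nu>\<close> is quasi-primary of weight 2, its opposite field is the field itself up to a shift of
  modes, and invariance makes \<open>L\<^sub>0\<close> self-adjoint.
\<close>

lemma invariant_form_L0:
  assumes f: "sesquilinear f" "invariant_wrt \<theta> f" and \<theta>: "\<theta> \<nu> = \<nu>"
  shows "f (L 0 b) c = f b (L 0 c)"
proof (cases "\<nu> = 0")
  \<comment> \<open>here the sum in the invariance condition is empty, but all \<open>L\<^sub>n\<close> vanish\<close>
  case True
  then show ?thesis using f(1) by (simp add: virasoro_mode_def Y_simps sesquilinearD)
next
  case False
  have "(\<Sum>j | opposite_coeff \<nu> j \<noteq> 0. f (Y (\<theta> (opposite_coeff \<nu> j)) (- 1 - 2 - j) b) c) = f b (Y \<nu> 1 c)"
    using f(2) unfolding invariant_wrt_def by blast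
  moreover have "{j. opposite_coeff \<nu> j \<noteq> 0} = {- 4}"
    using False by (auto simp: opposite_coeff_conformal_vector)
  ultimately show ?thesis by (simp add: opposite_coeff_conformal_vector \<theta> virasoro_mode_def)
qed

lemma invariant_form_weights_orthogonal:
  assumes f: "sesquilinear f" "invariant_wrt \<theta> f" and \<theta>: "\<theta> \<nu> = \<nu>"
    and ab: "a \<in> W m" "b \<in> W n" "m \<noteq> n"
  shows "f a b = 0"
proof -
  have "of_int m * f a b = of_int n * f a b"
    using invariant_form_L0[OF f \<theta>, of a b] ab(1,2) by (simp add: W_iff sesquilinearD[OF f(1)])
  then show ?thesis using ab(3) by simp
qed

text \<open>Schur's lemma: the eigenspaces of an operator commuting with all modes are ideals.\<close>

lemma commuting_operator_scalar:
  assumes simp: simple and T: "linop T" "\<And>a n x. T (Y a n x) = Y a n (T x)" and "\<Omega> \<noteq> 0"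
  obtains l where "\<And>x. T x = l *s x"
proof -
  obtain B where B: "finite B" "W 0 \<subseteq> span B" using weight_finite_dim by blast
  have "(T ^^ k) \<Omega> \<in> W 0" for k
  proof (induction k)
    case (Suc k)
    then show ?case by (simp add: W_iff virasoro_mode_def T(2)[symmetric] linop_0[OF T(1)])
  qed (simp add: vacuum_W)
  then have "(T ^^ k) \<Omega> \<in> span B" for k using B(2) by (rule subsetD[rotated])
  then obtain l x where lx: "x \<noteq> 0" "T x = l *s x"
    by (rule eigenvector_exists[OF T(1) B(1) _ \<open>\<Omega> \<noteq> 0\<close>])
  have "ideal {x. T x = l *s x}"
    unfolding ideal_def using subspace_eigenspace[OF T(1)] T(2) by (simp add: Y_simps)
  then have "{x. T x = l *s x} = UNIV" using simp lx unfolding simple_def by auto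
  then show ?thesis by (intro that[of l]) auto
qed

lemma autD:
  assumes "g \<in> aut"
  shows "linop g" "bij g" "g (Y a n b) = Y (g a) n (g b)" "g \<Omega> = \<Omega>" "g \<nu> = \<nu>"
  using assms by (simp_all add: aut_def)

lemma aut_0_iff: "g \<in> aut \<Longrightarrow> g x = 0 \<longleftrightarrow> x = 0"
  using linop_0[OF autD(1)] autD(2) by (metis bij_is_inj injD)

lemma aut_L: "g \<in> aut \<Longrightarrow> g (L n x) = L n (g x)"
  by (simp add: virasoro_mode_def autD)

lemma aut_W: "g \<in> aut \<Longrightarrow> x \<in> W n \<Longrightarrow> g x \<in> W n"
  by (simp add: W_iff aut_L[symmetric] linop_scale[OF autD(1)])

lemma aut_opposite_coeff: "g \<in> aut \<Longrightarrow> opposite_coeff (g a) j = g (opposite_coeff a j)"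
  by (rule opposite_coeff_natural) (simp_all add: autD bij_is_inj aut_L linop_add linop_scale)

lemma aut_comp: "g \<in> aut \<Longrightarrow> h \<in> aut \<Longrightarrow> g \<circ> h \<in> aut"
  unfolding aut_def by (auto intro: Vector_Spaces.linear_compose bij_comp)

lemma aut_id: "id \<in> aut"
  unfolding aut_def by (auto intro: linear_id)

lemma aut_inv_cancel: "g \<in> aut \<Longrightarrow> inv_into UNIV g (g x) = x" "g \<in> aut \<Longrightarrow> g (inv_into UNIV g x) = x"
  by (auto dest: autD(2) simp: bij_is_inj bij_is_surj surj_f_inv_f)

lemma aut_inv: 
  assumes g: "g \<in> aut"
  shows "inv_into UNIV g \<in> aut"
proof -
  have inj: "x = y" if "g x = g y" for x y using that autD(2)[OF g] by (metis bij_is_inj injD)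
  note c = aut_inv_cancel[OF g]
  have "inv_into UNIV g (x + y) = inv_into UNIV g x + inv_into UNIV g y" for x y
    by (rule inj) (simp add: c linop_add[OF autD(1)[OF g]])
  moreover have "inv_into UNIV g (k *s x) = k *s inv_into UNIV g x" for k x
    by (rule inj) (simp add: c linop_scale[OF autD(1)[OF g]])
  ultimately have "linop (inv_into UNIV g)" by (simp add: linop_iff)
  moreover have "inv_into UNIV g (Y a n b) = Y (inv_into UNIV g a) n (inv_into UNIV g b)" for a n b
    by (rule inj) (simp add: c autD[OF g])
  moreover have "inv_into UNIV g \<Omega> = \<Omega>" "inv_into UNIV g \<nu> = \<nu>"
    by (rule inj, simp add: c autD[OF g])+
  ultimately show ?thesis
    using autD(2)[OF g] unfolding aut_def by (simp add: bij_imp_bij_inv)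
qed

end


section \<open>Automorphisms of a simple unitary vertex operator algebra\<close>

locale simple_unitary_voa = voa scl Y \<Omega> \<nu>
  for scl :: "complex \<Rightarrow> 'v::ab_group_add \<Rightarrow> 'v" (infixr \<open>*s\<close> 75)
    and Y :: "'v \<Rightarrow> int \<Rightarrow> 'v \<Rightarrow> 'v" and \<Omega> \<nu> :: 'v +
  fixes ip :: "'v \<Rightarrow> 'v \<Rightarrow> complex" and \<theta> :: "'v \<Rightarrow> 'v"
  assumes scalar_product: "scalar_product ip"
    and normalized: "ip \<Omega> \<Omega> = 1"
    and pct_aut: "antilinear_aut \<theta>"
    and pct_involution: "\<theta> \<circ> \<theta> = id"
    and invariant: "invariant_wrt \<theta> ip"
    and simple: simple

sublocale simple_unitary_voa \<subseteq> complex_inner_product_space scl ip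
proof (intro complex_inner_product_space.intro complex_inner_product_space_axioms.intro)
  show "complex_vector_space scl" by (rule complex_vector_space_axioms)
  note sp = scalar_product[unfolded scalar_product_def]
  show "Vector_Spaces.linear scl (*) (ip a)" for a using sp by (elim conjE) (rule spec)
  show "ip b a = cnj (ip a b)" for a b using sp by (elim conjE) (drule spec, erule spec)
  show "0 < Re (ip a a)" if "a \<noteq> 0" for a using sp that by (elim conjE) (erule allE, erule mp)
qed

context simple_unitary_voa
begin

lemma theta:
  "\<theta> (x + y) = \<theta> x + \<theta> y" "\<theta> (k *s x) = cnj k *s \<theta> x" "\<theta> (Y a n b) = Y (\<theta> a) n (\<theta> b)"
  "\<theta> \<Omega> = \<Omega>" "\<theta> \<nu> = \<nu>" "\<theta> (\<theta> x) = x"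
proof -
  show "\<theta> (\<theta> x) = x" using fun_cong[OF pct_involution, of x] by simp
qed (use pct_aut in \<open>simp_all add: antilinear_aut_def Vector_Spaces.linear_iff\<close>)

lemma theta_L: "\<theta> (L n x) = L n (\<theta> x)"
  by (simp add: virasoro_mode_def theta)

lemma theta_W: "x \<in> W n \<Longrightarrow> \<theta> x \<in> W n"
  by (simp add: W_iff theta_L[symmetric] theta)

lemma theta_opposite_coeff: "opposite_coeff (\<theta> a) j = \<theta> (opposite_coeff a j)"
proof (rule opposite_coeff_natural)
  show "inj \<theta>" using pct_aut by (simp add: antilinear_aut_def bij_is_inj)
qed (simp_all add: theta theta_L)

lemma theta_eq_iff: "\<theta> x = \<theta> y \<longleftrightarrow> x = y"
  by (metis theta(6))

lemma theta_0: "\<theta> 0 = 0"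
  using theta(2)[of 0 0] by simp

lemma sesquilinear_ip: "sesquilinear ip"
  by (simp add: sesquilinear_def ip_bilinear)

lemma weights_orthogonal: "a \<in> W m \<Longrightarrow> b \<in> W n \<Longrightarrow> m \<noteq> n \<Longrightarrow> ip a b = 0"
  by (rule invariant_form_weights_orthogonal[OF sesquilinear_ip invariant theta(5)])

definition onb :: "int \<Rightarrow> 'v set" where
  "onb n = (SOME E. finite E \<and> orthonormal E \<and> span E = W n)"

lemma onb: "finite (onb n)" "orthonormal (onb n)" "span (onb n) = W n"
proof -
  obtain B where "finite B" "W n \<subseteq> span B" using weight_finite_dim by blast
  then obtain E where "finite E" "orthonormal E" "span E = W n"
    using orthonormal_basis_exists[OF subspace_W] by metis
  then have "\<exists>E. finite E \<and> orthonormal E \<and> span E = W n" by blast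
  from someI_ex[OF this]
  show "finite (onb n)" "orthonormal (onb n)" "span (onb n) = W n" by (simp_all add: onb_def)
qed

lemma onb_W: "e \<in> onb n \<Longrightarrow> e \<in> W n"
  using onb(3) span_base by blast

lemma onb_expansion: "x \<in> W n \<Longrightarrow> x = (\<Sum>e\<in>onb n. ip e x *s e)"
  using orthonormal_expansion[OF onb(1,2)] onb(3) by blast

text \<open>
  Riesz representation, weight space by weight space; the orthogonality of the weight spaces
  replaces completeness.
\<close>

lemma form_representation:
  assumes f: "sesquilinear f" and orth: "\<And>a b m n. a \<in> W m \<Longrightarrow> b \<in> W n \<Longrightarrow> m \<noteq> n \<Longrightarrow> f a b = 0"
  obtains T where "linop T" "\<And>a b. f a b = ip a (T b)"
proof -
  have "\<exists>u. \<forall>a. f a b = ip a u" for b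
  proof -
    have "b \<in> span (\<Union>n. W n)" using weight_decomposition by simp
    then show ?thesis
    proof (induction rule: span_induct_alt)
      case base
      then show ?case by (intro exI[of _ 0]) (simp add: sesquilinearD[OF f])
    next
      case (step c b y)
      then obtain n u where n: "b \<in> W n" and u: "\<forall>a. f a y = ip a u" by blast
      define w where "w = (\<Sum>e\<in>onb n. f e b *s e)"
      have wW: "w \<in> W n" unfolding w_def
        by (intro subspace_sum[OF subspace_W] subspace_scale[OF subspace_W] onb_W)
      have "f a b = ip a w" for a
      proof -
        have "a \<in> span (\<Union>n. W n)" using weight_decomposition by simp
        then show ?thesis
        proof (induction rule: span_induct_alt)
          case base
          then show ?case by (simp add: sesquilinearD[OF f])
        next
          case (step k a z)
          then obtain m where m: "a \<in> W m" by blast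
          have "f a b = ip a w"
          proof (cases "m = n")
            case True
            have "f a b = (\<Sum>e\<in>onb n. cnj (ip e a) * f e b)"
              by (subst onb_expansion[of a n])
                (use m True in \<open>simp_all add: sesquilinear_sum_left[OF f] sesquilinearD[OF f]\<close>)
            also have "\<dots> = ip a w"
              unfolding w_def by (simp add: ip_sum_right ip_scale_right ip_cnj[of a] mult.commute)
            finally show ?thesis .
          next
            case False
            then show ?thesis using orth[OF m n] weights_orthogonal[OF m wW] by simp
          qed
          then show ?case using step by (simp add: sesquilinearD[OF f] ip_bilinear)
        qed
      qed
      then show ?case using u
        by (intro exI[of _ "c *s w + u"]) (simp add: sesquilinearD[OF f] ip_bilinear)
    qed
  qed
  then obtain T where T: "\<And>a b. f a b = ip a (T b)" by metis
  have "linop T" unfolding linop_iff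
    by (intro conjI allI ip_eqI) (simp_all add: T[symmetric] ip_bilinear sesquilinearD[OF f])
  then show ?thesis using T that by blast
qed

text \<open>
  The operator relating a second invariant form to the scalar product commutes with all modes, so it
  is a scalar.
\<close>

lemma invariant_form_unique:
  assumes f: "sesquilinear f" "invariant_wrt \<theta> f"
  shows "f a b = f \<Omega> \<Omega> * ip a b"
proof -
  obtain T where T: "linop T" "\<And>a b. f a b = ip a (T b)"
    using form_representation[OF f(1)] invariant_form_weights_orthogonal[OF f theta(5)] by metis
  have "T (Y a n c) = Y a n (T c)" for a n c
  proof (rule ip_eqI)
    fix b
    have "ip b (T (Y a n c)) = f b (Y a n c)" by (simp add: T)
    also have "\<dots> = (\<Sum>j | opposite_coeff a j \<noteq> 0. f (Y (\<theta> (opposite_coeff a j)) (- n - 2 - j) b) c)"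
      using f(2) by (simp add: invariant_wrt_def)
    also have "\<dots> = ip b (Y a n (T c))"
      using invariant by (simp add: invariant_wrt_def T)
    finally show "ip b (T (Y a n c)) = ip b (Y a n (T c))" .
  qed
  moreover have "\<Omega> \<noteq> 0" using normalized by auto
  ultimately obtain l where l: "\<And>x. T x = l *s x"
    using commuting_operator_scalar[OF simple T(1)] by blast
  then show ?thesis using T normalized by (simp add: ip_scale_right)
qed

text \<open>
  The complex conjugate of \<open>(\<theta> a | \<theta> b)\<close> is again an invariant normalized form with PCT operator \<open>\<theta>\<close>,
  so uniqueness makes \<open>\<theta>\<close> antiunitary.
\<close>

lemma theta_ip: "ip (\<theta> a) (\<theta> b) = cnj (ip a b)"
proof -
  let ?f = "\<lambda>a b. cnj (ip (\<theta> a) (\<theta> b))"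
  have "sesquilinear ?f" by (simp add: sesquilinear_def theta ip_bilinear)
  moreover have "invariant_wrt \<theta> ?f"
    unfolding invariant_wrt_def
  proof (intro allI)
    fix a b c m
    have "(\<Sum>j | opposite_coeff a j \<noteq> 0. cnj (ip (\<theta> (Y (\<theta> (opposite_coeff a j)) (- m - 2 - j) b)) (\<theta> c)))
      = cnj (\<Sum>j | opposite_coeff (\<theta> a) j \<noteq> 0. ip (Y (\<theta> (opposite_coeff (\<theta> a) j)) (- m - 2 - j) (\<theta> b)) (\<theta> c))"
      using theta_eq_iff[of _ 0] by (simp add: theta theta_opposite_coeff theta_0)
    also have "\<dots> = cnj (ip (\<theta> b) (Y (\<theta> a) m (\<theta> c)))"
      using invariant by (simp add: invariant_wrt_def)
    finally show "(\<Sum>j | opposite_coeff a j \<noteq> 0. cnj (ip (\<theta> (Y (\<theta> (opposite_coeff a j)) (- m - 2 - j) b)) (\<theta> c)))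
      = cnj (ip (\<theta> b) (\<theta> (Y a m c)))" by (simp add: theta)
  qed
  ultimately have "?f a b = ?f \<Omega> \<Omega> * ip a b" by (rule invariant_form_unique)
  then show ?thesis using normalized by (simp add: theta) (metis complex_cnj_cnj)
qed

lemma theta_nrm: "nrm (\<theta> x) = nrm x"
  by (simp add: nrm_def nrm2_def theta_ip)

text \<open>
  The bilinear form \<open>(\<theta> a | b)\<close> is invariant under automorphisms, being the only normalized
  invariant one. This is what makes the adjoint of an automorphism an automorphism.
\<close>

lemma aut_preserves_bilinear_form:
  assumes g: "g \<in> aut"
  shows "ip (\<theta> (g (\<theta> a))) (g b) = ip a b"
proof -
  let ?f = "\<lambda>a b. ip (\<theta> (g (\<theta> a))) (g b)"
  note g' = autD[OF g] linop_add[OF autD(1)[OF g]] linop_scale[OF autD(1)[OF g]]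
  note g' = g' aut_0_iff[OF g]
  have "sesquilinear ?f" by (simp add: sesquilinear_def theta ip_bilinear g')
  moreover have "invariant_wrt \<theta> ?f"
    unfolding invariant_wrt_def
  proof (intro allI)
    fix a b c m
    have "(\<Sum>j | opposite_coeff a j \<noteq> 0. ?f (Y (\<theta> (opposite_coeff a j)) (- m - 2 - j) b) c)
      = (\<Sum>j | opposite_coeff (g a) j \<noteq> 0. ip (Y (\<theta> (opposite_coeff (g a) j)) (- m - 2 - j) (\<theta> (g (\<theta> b)))) (g c))"
      by (simp add: theta aut_opposite_coeff[OF g] g')
    also have "\<dots> = ?f b (Y a m c)"
      using invariant by (simp add: invariant_wrt_def g')
    finally show "(\<Sum>j | opposite_coeff a j \<noteq> 0. ?f (Y (\<theta> (opposite_coeff a j)) (- m - 2 - j) b) c)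
      = ?f b (Y a m c)" .
  qed
  ultimately have "?f a b = ?f \<Omega> \<Omega> * ip a b" by (rule invariant_form_unique)
  then show ?thesis using normalized by (simp add: theta g')
qed

definition adj :: "('v \<Rightarrow> 'v) \<Rightarrow> 'v \<Rightarrow> 'v" where
  "adj g = (\<lambda>a. \<theta> (inv_into UNIV g (\<theta> a)))"

lemma adj_right: "g \<in> aut \<Longrightarrow> ip (adj g a) b = ip a (g b)"
  using aut_preserves_bilinear_form[of g "adj g a" b] by (simp add: adj_def theta aut_inv_cancel)

lemma adj_left: "g \<in> aut \<Longrightarrow> ip a (adj g b) = ip (g a) b"
  using adj_right[of g b a] by (subst (1 2) ip_cnj) simp

lemma theta_conj_aut:
  assumes "g \<in> aut"
  shows "(\<lambda>a. \<theta> (g (\<theta> a))) \<in> aut"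
proof -
  have "bij \<theta>" using pct_aut by (simp add: antilinear_aut_def)
  then have "bij (\<theta> \<circ> (g \<circ> \<theta>))" using autD(2)[OF assms] by (intro bij_comp)
  then show ?thesis
    using autD[OF assms] linop_add[OF autD(1)[OF assms]] linop_scale[OF autD(1)[OF assms]]
    by (simp add: aut_def linop_iff theta o_def)
qed

lemma adj_aut: "g \<in> aut \<Longrightarrow> adj g \<in> aut"
  unfolding adj_def by (intro theta_conj_aut aut_inv)

lemma aut_inv_eq_adj: "g \<in> aut \<Longrightarrow> inv_into UNIV g x = \<theta> (adj g (\<theta> x))"
  by (simp add: adj_def theta)

text \<open>
  The inverse of \<open>g\<close> is the conjugate of the adjoint by the antiunitary \<open>\<theta>\<close>, and an operator has the same
  norm as its adjoint. In particular, bounds on automorphisms control their inverses.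
\<close>

lemma aut_inv_bound:
  assumes g: "g \<in> aut" and bound: "\<And>x. x \<in> W n \<Longrightarrow> nrm (g x) \<le> C * nrm x" and x: "x \<in> W n"
  shows "nrm (inv_into UNIV g x) \<le> C * nrm x"
proof -
  let ?y = "\<theta> x" let ?z = "adj g ?y"
  have z: "?z \<in> W n" using aut_W[OF adj_aut[OF g] theta_W[OF x]] .
  have "nrm ?z * nrm ?z = cmod (ip ?z ?z)"
    by (simp add: ip_self nrm_power2[symmetric] power2_eq_square norm_mult)
  also have "\<dots> = cmod (ip ?y (g ?z))" by (simp add: adj_right[OF g])
  also have "\<dots> \<le> nrm ?y * nrm (g ?z)" by (rule cauchy_schwarz)
  also have "\<dots> \<le> nrm ?y * (C * nrm ?z)" using bound[OF z] by (rule mult_left_mono) simp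
  finally have le: "nrm ?z * nrm ?z \<le> (C * nrm ?y) * nrm ?z" by (simp only: mult_ac)
  have "nrm ?z \<le> C * nrm ?y"
  proof (cases "?z = 0")
    case True
    have "0 \<le> C * nrm ?y"
      using order_trans[OF nrm_nonneg bound[OF theta_W[OF x]]] .
    then show ?thesis using True by simp
  next
    case False
    then have "nrm ?z > 0" using nrm_nonneg[of ?z] nrm_eq_0_iff[of ?z] by linarith
    then show ?thesis using le by simp
  qed
  then show ?thesis by (simp add: aut_inv_eq_adj[OF g] theta_nrm)
qed

lemma positive_aut_diagonalizable:
  assumes T: "T \<in> aut" "selfadjoint T" and pos: "\<And>x. Re (ip x (T x)) \<ge> 0"
  shows "span {x. \<exists>m>0. T x = of_real m *s x} = UNIV"
proof -
  note lin = autD(1)[OF T(1)]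
  have "v \<in> span {x. \<exists>m>0. T x = of_real m *s x}" if v: "v \<in> W n" for v n
  proof -
    obtain B where B: "finite B" "W n \<subseteq> span B" using weight_finite_dim by blast
    have "(T ^^ k) v \<in> W n" for k by (induction k) (simp_all add: v aut_W[OF T(1)])
    then have "(T ^^ k) v \<in> span B" for k using B(2) by (rule subsetD[rotated])
    then obtain ls where ls: "fold (\<lambda>l x. T x - l *s x) ls v = 0"
      using annihilating_factors[OF lin B(1)] by blast
    have "x = 0" if "T x = 0" for x using that by (simp add: aut_0_iff[OF T(1)])
    then show ?thesis by (rule positive_in_span_eigenvectors[OF lin T(2) pos _ ls])
  qed
  then have "span (\<Union>n. W n) \<subseteq> span {x. \<exists>m>0. T x = of_real m *s x}"
    by (intro span_minimal subspace_span) auto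
  then show ?thesis using weight_decomposition by auto
qed

text \<open>
  Modes multiply eigenvalues of an automorphism, and so does \<open>m \<mapsto> m\<^sup>t\<close>; hence the powers of a
  positive automorphism are again automorphisms.
\<close>

lemma positive_power_aut:
  assumes T: "T \<in> aut" "selfadjoint T"
    and span: "span {x. \<exists>m>0. T x = of_real m *s x} = UNIV"
    and P: "is_positive_power T t P"
  shows "P \<in> aut"
proof -
  let ?E = "{x. \<exists>m>0. T x = of_real m *s x}"
  note lin = positive_power_linop[OF P] and T' = autD[OF T(1)]
  note eigen = positive_power_eigen[OF P]
  have E: "P (Y a n b) = Y (P a) n (P b)" if ab: "a \<in> ?E" "b \<in> ?E" for a b n
  proof -
    obtain m k where mk: "m > 0" "T a = of_real m *s a" "k > 0" "T b = of_real k *s b"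
      using ab by blast
    have "T (Y a n b) = of_real (m * k) *s Y a n b"
      by (simp add: T'(3) mk Y_simps)
    then have "P (Y a n b) = of_real ((m * k) powr t) *s Y a n b"
      using mk by (intro eigen) simp_all
    then show ?thesis using mk by (simp add: eigen Y_simps powr_mult)
  qed
  have E': "P (Y a n b) = Y (P a) n (P b)" if "a \<in> ?E" for a b n
  proof -
    have "b \<in> span ?E" using span by simp
    then show ?thesis
      by (induction rule: span_induct_alt)
        (simp_all add: linop_0[OF lin] linop_add[OF lin] linop_scale[OF lin] Y_simps E[OF that])
  qed
  have "P (Y a n b) = Y (P a) n (P b)" for a b n
  proof -
    have "a \<in> span ?E" using span by simp
    then show ?thesis
      by (induction rule: span_induct_alt)
        (simp_all add: linop_0[OF lin] linop_add[OF lin] linop_scale[OF lin] Y_simps E')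
  qed
  moreover have "P \<Omega> = \<Omega>" "P \<nu> = \<nu>"
    using eigen[of 1 \<Omega>] eigen[of 1 \<nu>] T' by simp_all
  moreover obtain Q where Q: "is_positive_power T (- t) Q"
    using positive_power_exists[OF T'(1) T(2)] by blast
  have "P (Q x) = x" "Q (P x) = x" for x
    using positive_power_add[OF span P Q, of "\<lambda>x. x"] positive_power_add[OF span Q P, of "\<lambda>x. x"]
      positive_power_0 by simp_all
  then have "bij P" by (intro o_bij[of Q]) (auto simp: fun_eq_iff)
  ultimately show ?thesis using lin by (simp add: aut_def)
qed

lemma positive_aut_roots:
  assumes T: "T \<in> aut" "selfadjoint T" and pos: "\<And>x. Re (ip x (T x)) \<ge> 0"
  obtains S R where "S \<in> aut" "selfadjoint S" "\<And>x. S (S x) = T x"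
    "R \<in> aut" "selfadjoint R" "\<And>x. R (R x) = S x"
proof -
  note span = positive_aut_diagonalizable[OF T pos]
  obtain S R where SR: "is_positive_power T (1/2) S" "is_positive_power T (1/4) R"
    using positive_power_exists[OF autD(1)[OF T(1)] T(2)] by metis
  note T1 = positive_power_1[OF autD(1)[OF T(1)]]
  show ?thesis
  proof (rule that)
    show "S \<in> aut" "R \<in> aut" using SR by (auto intro: positive_power_aut[OF T span])
    show "selfadjoint S" "selfadjoint R"
      using SR by (auto intro: positive_power_selfadjoint[OF span T(2)])
    show "S (S x) = T x" "R (R x) = S x" for x
      using positive_power_add[OF span SR(1) SR(1), of T] positive_power_add[OF span SR(2) SR(2), of S]
        SR T1 by simp_all
  qed
qed

text \<open>
  The polar part \<open>S\<close> of \<open>h' h\<^sup>-\<^sup>1\<close>. In the symmetric space of forms \<open>(h a | h b)\<close>, the root \<open>R h\<close> is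
  the midpoint of the geodesic from \<open>h\<close> to \<open>h'\<close>.
\<close>

lemma relative_polar_part:
  assumes h: "h \<in> aut" "h' \<in> aut"
  obtains S R where "S \<in> aut" "selfadjoint S" "R \<in> aut"
    "\<And>x. nrm2 (h' x) = nrm2 (S (h x))"
    "\<And>w. nrm2 (S w - w) = nrm2 (S w) + nrm2 w - 2 * nrm2 (R w)"
proof -
  define k where "k = h' \<circ> inv_into UNIV h"
  have k: "k \<in> aut" unfolding k_def using h by (intro aut_comp aut_inv)
  have kh: "k (h x) = h' x" for x by (simp add: k_def aut_inv_cancel[OF h(1)])
  define T where "T = adj k \<circ> k"
  have ipT: "ip x (T y) = ip (k x) (k y)" for x y by (simp add: T_def adj_left[OF k])
  have T: "T \<in> aut" unfolding T_def using k by (intro aut_comp adj_aut)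
  have sa: "selfadjoint T" unfolding selfadjoint_def by (subst ip_cnj) (simp add: ipT ip_cnj[of "k _" "k _", symmetric])
  have "Re (ip x (T x)) \<ge> 0" for x by (simp add: ipT nrm2_def[symmetric])
  then obtain S R where SR: "S \<in> aut" "selfadjoint S" "\<And>x. S (S x) = T x"
    "R \<in> aut" "selfadjoint R" "\<And>x. R (R x) = S x"
    using positive_aut_roots[OF T sa] by metis
  have S2: "nrm2 (S w) = Re (ip w (T w))" for w
    using SR(2,3) by (simp add: nrm2_def selfadjoint_def)
  have R2: "nrm2 (R w) = Re (ip w (S w))" for w
    using SR(5,6) by (simp add: nrm2_def selfadjoint_def)
  show ?thesis
  proof (rule that[OF SR(1,2,4)])
    show "nrm2 (h' x) = nrm2 (S (h x))" for x
      by (simp add: S2 ipT kh) (simp add: nrm2_def)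
    show "nrm2 (S w - w) = nrm2 (S w) + nrm2 w - 2 * nrm2 (R w)" for w
      using SR(2) by (simp add: nrm2_diff R2 selfadjoint_def)
  qed
qed

end


section \<open>Local compactness of the automorphism group\<close>

lemma finite_dim_lie_group_locally_compact:
  assumes "finite_dim_lie_group G X"
  shows "locally_compact_space X"
  unfolding locally_compact_space_def
proof
  fix x assume x: "x \<in> topspace X"
  from assms obtain n A where "smooth_atlas n X A"
    unfolding finite_dim_lie_group_def by blast
  then obtain U \<phi> where "x \<in> U" and chart: "is_chart n X (U, \<phi>)"
    using x unfolding smooth_atlas_def by blast
  then have U: "openin X U" "openin (Euclidean_space n) (\<phi> ` U)"
    and hom: "homeomorphic_map (subtopology X U) (subtopology (Euclidean_space n) (\<phi> ` U)) \<phi>"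
    by (simp_all add: is_chart_def)
  have "locally_compact_space (subtopology (Euclidean_space n) (\<phi> ` U))"
    using Hausdorff_Euclidean_space locally_compact_Euclidean_space U(2)
    by (blast intro: locally_compact_space_open_subset)
  then have "locally_compact_space (subtopology X U)"
    using homeomorphic_locally_compact_space[OF homeomorphic_map_imp_homeomorphic_space[OF hom]] by blast
  moreover have "x \<in> topspace (subtopology X U)" using \<open>x \<in> U\<close> x by simp
  ultimately obtain V K where "openin (subtopology X U) V" "compactin (subtopology X U) K" "x \<in> V" "V \<subseteq> K"
    unfolding locally_compact_space_def by meson
  then show "\<exists>V K. openin X V \<and> compactin X K \<and> x \<in> V \<and> V \<subseteq> K"
    using openin_open_subtopology[OF U(1)] by (meson compactin_subtopology)
qed

context simple_unitary_voa
begin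

lemma restrict_aut_GL:
  assumes g: "g \<in> aut"
  shows "restrict g (W n) \<in> GL (W n)"
proof -
  have "bij_betw g (W n) (W n)"
    by (rule bij_betwI[of _ _ _ "inv_into UNIV g"])
      (use aut_W[OF g] aut_W[OF aut_inv[OF g]] in \<open>auto simp: aut_inv_cancel[OF g]\<close>)
  then show ?thesis using autD(1)[OF g] by (auto simp: GL_def)
qed

lemma topspace_GL_W: "topspace (GL_topology (W n)) = GL (W n)"
proof -
  have "GL (W n) \<in> {{h \<in> GL (W n). f (h a) \<in> U} | f a U.
      Vector_Spaces.linear scl (*) f \<and> a \<in> W n \<and> open U}"
    using ip_linear[of 0] subspace_0[OF subspace_W]
    by (intro CollectI exI[of _ "ip 0"] exI[of _ 0] exI[of _ UNIV]) auto
  then show ?thesis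
    unfolding GL_topology_def topology_generated_by_topspace by auto
qed

lemma restrict_aut_topspace:
  "g \<in> aut \<Longrightarrow> (\<lambda>n. restrict g (W n)) \<in> topspace (product_topology (\<lambda>n. GL_topology (W n)) UNIV)"
  by (auto simp: topspace_product_topology topspace_GL_W PiE_UNIV_domain intro!: restrict_aut_GL simp del: restrict_apply)

lemma topspace_aut_topology: "topspace aut_topology = aut"
  unfolding aut_topology_def topspace_pullback_topology using restrict_aut_topspace by blast

lemma continuous_map_matrix_coefficient:
  assumes f: "Vector_Spaces.linear scl (*) f" and a: "a \<in> W n"
  shows "continuous_map aut_topology euclidean (\<lambda>g. f (g a))"
proof -
  have GL: "continuous_map (GL_topology (W n)) euclidean (\<lambda>h. f (h a))"
    unfolding continuous_map_def
  proof (intro conjI allI impI)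
    fix U :: "complex set" assume "openin euclidean U"
    then have "{h \<in> GL (W n). f (h a) \<in> U} \<in> {{h \<in> GL (W n). f (h a) \<in> U} | f a U.
      Vector_Spaces.linear scl (*) f \<and> a \<in> W n \<and> open U}"
      using f a by auto
    then show "openin (GL_topology (W n)) {h \<in> topspace (GL_topology (W n)). f (h a) \<in> U}"
      unfolding topspace_GL_W unfolding GL_topology_def by (rule topology_generated_by_Basis)
  qed simp
  have "continuous_map (product_topology (\<lambda>n. GL_topology (W n)) UNIV) euclidean
      ((\<lambda>h. f (h a)) \<circ> (\<lambda>H. H n))"
    by (rule continuous_map_compose[OF _ GL], rule continuous_map_product_projection[of n UNIV "\<lambda>n. GL_topology (W n)"]) simp
  then have "continuous_map aut_topology euclidean
      ((\<lambda>h. f (h a)) \<circ> (\<lambda>H. H n) \<circ> (\<lambda>g n. restrict g (W n)))"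
    unfolding aut_topology_def by (rule continuous_map_pullback)
  then show ?thesis using a by (simp add: o_def)
qed

lemma compactin_aut_bounded:
  assumes K: "compactin aut_topology K"
  obtains C where "\<And>g x. g \<in> K \<Longrightarrow> x \<in> W n \<Longrightarrow> nrm (g x) \<le> C * nrm x"
proof -
  have Kaut: "K \<subseteq> aut" using compactin_subset_topspace[OF K] by (simp add: topspace_aut_topology)
  have "\<exists>b. \<forall>g\<in>K. cmod (ip e' (g e)) \<le> b" if "e \<in> onb n" for e e'
  proof -
    have "compactin euclidean ((\<lambda>g. ip e' (g e)) ` K)"
      by (rule image_compactin[OF K continuous_map_matrix_coefficient[OF ip_linear onb_W[OF that]]])
    then have "bounded ((\<lambda>g. ip e' (g e)) ` K)" by (simp add: compact_imp_bounded)
    then show ?thesis by (auto simp: bounded_iff)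
  qed
  then obtain b where b: "\<And>g e e'. g \<in> K \<Longrightarrow> e \<in> onb n \<Longrightarrow> cmod (ip e' (g e)) \<le> b e e'"
    by metis
  show ?thesis
  proof (rule that)
    fix g x assume g: "g \<in> K" and x: "x \<in> W n"
    have g': "g \<in> aut" using g Kaut by blast
    have "nrm (g x) \<le> (\<Sum>e\<in>onb n. nrm (g e)) * nrm x"
      by (rule nrm_le_sum_basis[OF onb(1,2) _ autD(1)[OF g']]) (simp add: onb(3) x)
    also have "\<dots> \<le> (\<Sum>e\<in>onb n. \<Sum>e'\<in>onb n. b e e') * nrm x"
    proof (intro mult_right_mono sum_mono)
      fix e assume e: "e \<in> onb n"
      have "nrm (g e) \<le> (\<Sum>e'\<in>onb n. nrm (ip e' (g e) *s e'))"
        by (subst onb_expansion[OF aut_W[OF g' onb_W[OF e]]]) (rule nrm_sum)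
      also have "\<dots> \<le> (\<Sum>e'\<in>onb n. b e e')"
        using b[OF g e] orthonormal_nrm[OF onb(2)] by (intro sum_mono) (simp add: nrm_scale)
      finally show "nrm (g e) \<le> (\<Sum>e'\<in>onb n. b e e')" .
    qed simp
    finally show "nrm (g x) \<le> (\<Sum>e\<in>onb n. \<Sum>e'\<in>onb n. b e e') * nrm x" .
  qed
qed

definition near_id :: "int \<Rightarrow> real \<Rightarrow> ('v \<Rightarrow> 'v) \<Rightarrow> bool" where
  "near_id n \<epsilon> g \<longleftrightarrow> (\<forall>x\<in>W n. nrm (g x - x) \<le> \<epsilon> * nrm x)"

lemma near_id_mono: "near_id n \<epsilon> g \<Longrightarrow> \<epsilon> \<le> \<delta> \<Longrightarrow> near_id n \<delta> g"
  unfolding near_id_def by (meson mult_right_mono nrm_nonneg order_trans)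

text \<open>
  A subbasic neighbourhood of the identity constrains one matrix coefficient \<open>f (g a)\<close>, and a linear
  functional is bounded on a finite-dimensional space.
\<close>

lemma GL_topology_nhds_id:
  assumes "openin (GL_topology (W n)) V" "restrict id (W n) \<in> V"
  shows "\<exists>\<epsilon>>0. \<forall>g\<in>aut. near_id n \<epsilon> g \<longrightarrow> restrict g (W n) \<in> V"
proof -
  let ?B = "{{h \<in> GL (W n). f (h a) \<in> U} | f a U. Vector_Spaces.linear scl (*) f \<and> a \<in> W n \<and> open U}"
  have "generate_topology_on ?B V"
    using assms(1) unfolding GL_topology_def by (rule openin_topology_generated_by)
  then show ?thesis using assms(2)
  proof (induction rule: generate_topology_on.induct)
    case (Int A B)
    then obtain \<epsilon> \<delta> where "\<epsilon> > 0" "\<forall>g\<in>aut. near_id n \<epsilon> g \<longrightarrow> restrict g (W n) \<in> A"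
      "\<delta> > 0" "\<forall>g\<in>aut. near_id n \<delta> g \<longrightarrow> restrict g (W n) \<in> B" by blast
    then show ?case
      by (intro exI[of _ "min \<epsilon> \<delta>"])
        (meson IntI min_less_iff_conj min.cobounded1 min.cobounded2 near_id_mono)
  next
    case (UN K)
    then obtain k where "k \<in> K" "restrict id (W n) \<in> k" by blast
    then show ?case using UN.IH[of k] by blast
  next
    case (Basis s)
    then obtain f a U where s: "s = {h \<in> GL (W n). f (h a) \<in> U}"
      and f: "Vector_Spaces.linear scl (*) f" and a: "a \<in> W n" and U: "open U" by blast
    have fadd: "f (x + y) = f x + f y" and fscale: "f (c *s x) = c * f x" for x y c
      using f by (simp_all add: Vector_Spaces.linear_iff)
    have fsum: "f (sum g A) = (\<Sum>i\<in>A. f (g i))" for g :: "'v \<Rightarrow> 'v" and A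
      using fscale[of 0 0] by (induction A rule: infinite_finite_induct) (simp_all add: fadd)
    define M where "M = (\<Sum>e\<in>onb n. cmod (f e))"
    have M0: "M \<ge> 0" by (simp add: M_def sum_nonneg)
    have M: "cmod (f y) \<le> M * nrm y" if y: "y \<in> W n" for y
    proof -
      have "f y = (\<Sum>e\<in>onb n. ip e y * f e)"
        by (subst onb_expansion[OF y]) (simp add: fsum fscale)
      then have "cmod (f y) \<le> (\<Sum>e\<in>onb n. cmod (ip e y * f e))" by (simp add: norm_sum)
      also have "\<dots> \<le> (\<Sum>e\<in>onb n. cmod (f e) * nrm y)"
      proof (rule sum_mono)
        fix e assume "e \<in> onb n"
        then have "cmod (ip e y) \<le> nrm y"
          using cauchy_schwarz[of e y] orthonormal_nrm[OF onb(2)] by simp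
        then show "cmod (ip e y * f e) \<le> cmod (f e) * nrm y"
          by (simp add: norm_mult mult_left_mono mult.commute[of "cmod (ip e y)"])
      qed
      finally show ?thesis by (simp add: M_def sum_distrib_right)
    qed
    have "f a \<in> U" using Basis a s by simp
    then obtain \<delta> where \<delta>: "\<delta> > 0" "ball (f a) \<delta> \<subseteq> U" using U open_contains_ball by blast
    define \<epsilon> where "\<epsilon> = \<delta> / ((M + 1) * (nrm a + 1))"
    have pos: "(M + 1) * (nrm a + 1) > 0"
      using M0 nrm_nonneg[of a] by (intro mult_pos_pos) linarith+
    then have "\<epsilon> > 0" using \<delta>(1) by (simp add: \<epsilon>_def)
    moreover have "restrict g (W n) \<in> s" if g: "g \<in> aut" "near_id n \<epsilon> g" for g
    proof -
      have "f (g a) = f (g a - a) + f a" using fadd[of "g a - a" a] by simp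
      then have "cmod (f (g a) - f a) \<le> M * nrm (g a - a)"
        using M[OF subspace_diff[OF subspace_W aut_W[OF g(1) a] a]] by simp
      also have "\<dots> \<le> M * (\<epsilon> * nrm a)"
        using g(2) a M0 by (intro mult_left_mono) (auto simp: near_id_def)
      also have "\<dots> < \<epsilon> * ((M + 1) * (nrm a + 1))"
      proof -
        have "M * nrm a < (M + 1) * (nrm a + 1)"
          using M0 nrm_nonneg[of a] by (simp add: algebra_simps del: nrm_nonneg)
        then show ?thesis using \<open>\<epsilon> > 0\<close> by (simp add: mult_ac)
      qed
      also have "\<dots> = \<delta>"
        unfolding \<epsilon>_def using pos by (intro nonzero_eq_divide_eq[THEN iffD1, OF _ refl]) linarith
      finally have "f (g a) \<in> U" using \<delta>(2) by (auto simp: subset_iff dist_norm norm_minus_commute)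
      then show ?thesis using restrict_aut_GL[OF g(1)] a by (simp add: s)
    qed
    ultimately show ?case by blast
  qed simp
qed

lemma aut_topology_nhds_id:
  assumes U: "openin aut_topology U" "id \<in> U"
  obtains I \<epsilon> where "finite I" "\<epsilon> > 0"
    "\<And>g. g \<in> aut \<Longrightarrow> (\<And>i. i \<in> I \<Longrightarrow> near_id i \<epsilon> g) \<Longrightarrow> g \<in> U"
proof -
  let ?F = "\<lambda>g n. restrict g (W n)"
  obtain V where V: "openin (product_topology (\<lambda>n. GL_topology (W n)) UNIV) V" "U = ?F -` V \<inter> aut"
    using U(1) unfolding aut_topology_def openin_pullback_topology by blast
  have "?F id \<in> V" using U(2) V(2) by blast
  then obtain X where X: "?F id \<in> (\<Pi>\<^sub>E i\<in>UNIV. X i)" "\<And>i. openin (GL_topology (W i)) (X i)"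
    "finite {i. X i \<noteq> topspace (GL_topology (W i))}" "(\<Pi>\<^sub>E i\<in>UNIV. X i) \<subseteq> V"
    using product_topology_open_contains_basis[OF V(1)] by meson
  define I where "I = {i. X i \<noteq> topspace (GL_topology (W i))}"
  have "restrict id (W i) \<in> X i" for i using X(1) by (simp add: PiE_iff)
  then obtain \<epsilon> where \<epsilon>: "\<And>i. \<epsilon> i > 0" "\<And>i g. g \<in> aut \<Longrightarrow> near_id i (\<epsilon> i) g \<Longrightarrow> restrict g (W i) \<in> X i"
    using GL_topology_nhds_id[OF X(2)] by metis
  define \<delta> where "\<delta> = Min (insert 1 (\<epsilon> ` I))"
  have fin: "finite I" using X(3) by (simp add: I_def)
  have "\<delta> > 0" unfolding \<delta>_def using fin \<epsilon>(1) by (subst Min_gr_iff) auto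
  moreover have "g \<in> U" if g: "g \<in> aut" "\<And>i. i \<in> I \<Longrightarrow> near_id i \<delta> g" for g
  proof -
    have "restrict g (W i) \<in> X i" for i
    proof (cases "i \<in> I")
      case True
      then have "\<delta> \<le> \<epsilon> i" unfolding \<delta>_def using fin by (intro Min_le) auto
      then show ?thesis using \<epsilon>(2)[OF g(1)] near_id_mono g(2)[OF True] by blast
    next
      case False
      then show ?thesis using restrict_aut_GL[OF g(1)] by (simp add: I_def topspace_GL_W)
    qed
    then show ?thesis using X(4) g(1) unfolding V(2) by (auto simp: subset_iff PiE_iff)
  qed
  ultimately show ?thesis using that fin by blast
qed

text \<open>
  A compact neighbourhood of the identity is bounded on each weight space. It contains a basic
  neighbourhood, and membership in the latter depends on finitely many weight spaces.
\<close>

lemma locally_compact_uniform_bound: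
  assumes "locally_compact_space aut_topology"
  obtains I \<epsilon> C where "finite I" "\<epsilon> > 0"
    "\<And>g n x. g \<in> aut \<Longrightarrow> (\<And>i. i \<in> I \<Longrightarrow> near_id i \<epsilon> g) \<Longrightarrow> x \<in> W n \<Longrightarrow> nrm (g x) \<le> C n * nrm x"
proof -
  have "id \<in> topspace aut_topology" by (simp add: topspace_aut_topology aut_id)
  then obtain U K where U: "openin aut_topology U" "id \<in> U" and K: "compactin aut_topology K" "U \<subseteq> K"
    using assms unfolding locally_compact_space_def by meson
  obtain I \<epsilon> where I: "finite I" "\<epsilon> > 0"
    "\<And>g. g \<in> aut \<Longrightarrow> (\<And>i. i \<in> I \<Longrightarrow> near_id i \<epsilon> g) \<Longrightarrow> g \<in> U"
    using aut_topology_nhds_id[OF U] by blast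
  have "\<exists>C. \<forall>g\<in>K. \<forall>x\<in>W n. nrm (g x) \<le> C * nrm x" for n
    using compactin_aut_bounded[OF K(1), of n] by metis
  then obtain C where "\<And>n g x. g \<in> K \<Longrightarrow> x \<in> W n \<Longrightarrow> nrm (g x) \<le> C n * nrm x" by metis
  then show ?thesis using I K(2) by (intro that[of I \<epsilon> C]) blast+
qed

end


section \<open>Minimizing sequences\<close>

context simple_unitary_voa
begin

lemma aut_funpow: "g \<in> aut \<Longrightarrow> g ^^ k \<in> aut"
  by (induction k) (simp_all add: aut_id aut_comp)

lemma bound_from_basis:
  assumes T: "linop T" and b: "\<And>e. e \<in> onb n \<Longrightarrow> nrm2 (T e) \<le> c\<^sup>2" and c: "c \<ge> 0" and x: "x \<in> W n"
  shows "nrm (T x) \<le> real (card (onb n)) * c * nrm x"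
proof -
  have "nrm (T x) \<le> (\<Sum>e\<in>onb n. nrm (T e)) * nrm x"
    by (rule nrm_le_sum_basis[OF onb(1,2) _ T]) (simp add: onb(3) x)
  also have "\<dots> \<le> (\<Sum>e\<in>onb n. c) * nrm x"
  proof (intro mult_right_mono sum_mono)
    fix e assume "e \<in> onb n"
    then have "(nrm (T e))\<^sup>2 \<le> c\<^sup>2" using b by (simp add: nrm_power2)
    then show "nrm (T e) \<le> c" using c by (rule power2_le_imp_le)
  qed simp
  finally show ?thesis by simp
qed

lemma nrm2_weight_decomposition:
  assumes h: "h \<in> aut"
  shows "nrm2 (h a) = (\<Sum>d | weight_component a d \<noteq> 0. nrm2 (h (weight_component a d)))"
proof -
  let ?D = "{d. weight_component a d \<noteq> 0}" and ?w = "weight_component a"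
  note wc = weight_component_props[of a]
  have "h a = (\<Sum>d\<in>?D. h (?w d))"
    by (subst wc(3)[symmetric]) (simp add: linop_sum[OF autD(1)[OF h]])
  then have "ip (h a) (h a) = (\<Sum>d\<in>?D. \<Sum>e\<in>?D. ip (h (?w d)) (h (?w e)))"
    by (simp only: ip_sum_left) (simp only: ip_sum_right)
  also have "\<dots> = (\<Sum>d\<in>?D. \<Sum>e\<in>?D. if e = d then ip (h (?w d)) (h (?w d)) else 0)"
    using weights_orthogonal[OF aut_W[OF h wc(1)] aut_W[OF h wc(1)]] by (intro sum.cong refl) auto
  also have "\<dots> = (\<Sum>d\<in>?D. ip (h (?w d)) (h (?w d)))" using wc(2) by simp
  finally show ?thesis by (simp add: nrm2_def)
qed

end

text \<open>
  What compactness of the subgroup and local compactness of the automorphism group contribute, in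
  terms of norms. The weight spaces indexed by \<open>I\<close> are called distinguished below.
\<close>

locale bounded_aut_subgroup = simple_unitary_voa scl Y \<Omega> \<nu> ip \<theta>
  for scl :: "complex \<Rightarrow> 'v::ab_group_add \<Rightarrow> 'v" (infixr \<open>*s\<close> 75)
    and Y :: "'v \<Rightarrow> int \<Rightarrow> 'v \<Rightarrow> 'v" and \<Omega> \<nu> :: 'v
    and ip :: "'v \<Rightarrow> 'v \<Rightarrow> complex" and \<theta> :: "'v \<Rightarrow> 'v" +
  fixes G :: "('v \<Rightarrow> 'v) set" and B :: "int \<Rightarrow> real"
    and I :: "int set" and \<epsilon> :: real and C :: "int \<Rightarrow> real"
  assumes G_aut: "G \<subseteq> aut" and G_id: "id \<in> G" and G_comp: "g \<in> G \<Longrightarrow> g' \<in> G \<Longrightarrow> g \<circ> g' \<in> G"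
    and G_bounded: "g \<in> G \<Longrightarrow> x \<in> W n \<Longrightarrow> nrm (g x) \<le> B n * nrm x"
    and fin_I: "finite I" and eps_pos: "\<epsilon> > 0"
    and uniform_bound: "g \<in> aut \<Longrightarrow> (\<And>i. i \<in> I \<Longrightarrow> near_id i \<epsilon> g) \<Longrightarrow> x \<in> W n
      \<Longrightarrow> nrm (g x) \<le> C n * nrm x"
begin

text \<open>
  If \<open>S\<close> is close to the identity on the distinguished weight spaces then so is a high power of
  \<open>S\<close>, and a bound \<open>C\<close> for \<open>S\<^sup>M\<close> is a bound \<open>C\<^bsup>1/M\<^esup>\<close> for \<open>S\<close>.
\<close>

lemma selfadjoint_aut_contraction:
  assumes c: "c > 1"
  shows "\<exists>\<eta>>0. \<forall>S\<in>aut. selfadjoint S \<longrightarrow> (\<forall>i\<in>I. near_id i \<eta> S) \<longrightarrow>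
    (\<forall>x\<in>W n. nrm2 (S x) \<le> c * nrm2 x)"
proof -
  have "sqrt c > 1" using c by simp
  then obtain M0 where M0: "C n < sqrt c ^ M0" using real_arch_pow by blast
  define M where "M = Suc M0"
  have "sqrt c ^ M0 \<le> sqrt c ^ M" unfolding M_def using \<open>sqrt c > 1\<close> by (intro power_increasing) auto
  then have M: "C n \<le> sqrt c ^ M" "M > 0" using M0 by (simp_all add: M_def)
  \<comment> \<open>chosen so that \<open>\<eta>\<close>-closeness of \<open>S\<close> to the identity is \<open>\<epsilon>\<close>-closeness of \<open>S\<^sup>M\<close>\<close>
  define \<eta> where "\<eta> = root M (1 + \<epsilon>) - 1"
  have \<eta>: "\<eta> > 0" "(1 + \<eta>) ^ M = 1 + \<epsilon>"
    using M(2) eps_pos by (simp_all add: \<eta>_def)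
  have "nrm2 (S x) \<le> c * nrm2 x"
    if S: "S \<in> aut" "selfadjoint S" "\<And>i. i \<in> I \<Longrightarrow> near_id i \<eta> S" and x: "x \<in> W n" for S x
  proof (cases "x = 0")
    case True
    then show ?thesis by (simp add: linop_0[OF autD(1)[OF S(1)]])
  next
    case False
    then have pos: "nrm x > 0" using nrm_nonneg[of x] nrm_eq_0_iff[of x] by linarith
    have "near_id i \<epsilon> (S ^^ M)" if "i \<in> I" for i
      unfolding near_id_def
    proof
      fix y assume y: "y \<in> W i"
      have "nrm ((S ^^ M) y - y) \<le> ((1 + \<eta>) ^ M - 1) * nrm y"
        using S(3)[OF that] aut_W[OF S(1)] y
        by (intro near_identity_power[OF autD(1)[OF S(1)] _ subspace_W]) (auto simp: near_id_def)
      then show "nrm ((S ^^ M) y - y) \<le> \<epsilon> * nrm y" by (simp add: \<eta>(2))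
    qed
    then have "nrm ((S ^^ M) x) \<le> C n * nrm x"
      using uniform_bound[OF aut_funpow[OF S(1)] _ x] by blast
    also have "\<dots> \<le> sqrt c ^ M * nrm x" using M(1) by (rule mult_right_mono) simp
    finally have "nrm x ^ M * nrm ((S ^^ M) x) \<le> nrm x ^ M * (sqrt c ^ M * nrm x)"
      by (rule mult_left_mono) simp
    then have "nrm (S x) ^ M * nrm x \<le> (sqrt c * nrm x) ^ M * nrm x"
      using selfadjoint_power_bound[OF S(2), of x M] by (simp add: power_mult_distrib mult_ac)
    then have "nrm (S x) ^ M \<le> (sqrt c * nrm x) ^ M" using pos by simp
    then have "nrm (S x) \<le> sqrt c * nrm x"
      unfolding M_def by (rule power_le_imp_le_base) (use c in simp)
    then have "(nrm (S x))\<^sup>2 \<le> (sqrt c * nrm x)\<^sup>2" by (rule power_mono) simp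
    then show ?thesis using c by (simp add: power_mult_distrib nrm_power2)
  qed
  then show ?thesis using \<eta>(1) by blast
qed

text \<open>The trace of \<open>k\<^sup>* k\<close> on the distinguished weight spaces.\<close>

definition energy :: "('v \<Rightarrow> 'v) \<Rightarrow> real" where
  "energy k = (\<Sum>i\<in>I. \<Sum>e\<in>onb i. nrm2 (k e))"

definition sup_energy :: "('v \<Rightarrow> 'v) \<Rightarrow> real" where
  "sup_energy h = (SUP g\<in>G. energy (h \<circ> g))"

definition min_energy :: real where
  "min_energy = (INF h\<in>aut. sup_energy h)"

lemma energy_nonneg: "0 \<le> energy k"
  by (simp add: energy_def sum_nonneg)

lemma basis_le_energy:
  assumes "i \<in> I" "e \<in> onb i"
  shows "nrm2 (k e) \<le> energy k"
proof -
  have "nrm2 (k e) \<le> (\<Sum>e\<in>onb i. nrm2 (k e))"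
    using assms(2) onb(1) by (intro member_le_sum[of e "onb i" "\<lambda>e. nrm2 (k e)"]) auto
  also have "\<dots> \<le> energy k"
    unfolding energy_def using assms(1) fin_I
    by (intro member_le_sum[of i I "\<lambda>i. \<Sum>e\<in>onb i. nrm2 (k e)"]) (auto intro: sum_nonneg)
  finally show ?thesis .
qed

lemma bdd_above_energy:
  assumes h: "h \<in> aut"
  shows "bdd_above ((\<lambda>g. energy (h \<circ> g)) ` G)"
proof (rule bdd_aboveI2)
  let ?H = "\<lambda>i. \<Sum>e\<in>onb i. nrm (h e)"
  fix g assume g: "g \<in> G"
  then have g': "g \<in> aut" using G_aut by blast
  show "energy (h \<circ> g) \<le> (\<Sum>i\<in>I. \<Sum>e\<in>onb i. (?H i * B i)\<^sup>2)"
    unfolding energy_def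
  proof (intro sum_mono)
    fix i e assume e: "e \<in> onb i"
    have "nrm (h (g e)) \<le> ?H i * nrm (g e)"
      by (rule nrm_le_sum_basis[OF onb(1,2) _ autD(1)[OF h]]) (simp add: onb(3) aut_W[OF g' onb_W[OF e]])
    also have "\<dots> \<le> ?H i * B i"
      using G_bounded[OF g onb_W[OF e]] orthonormal_nrm[OF onb(2) e]
      by (intro mult_left_mono) (auto intro: sum_nonneg)
    finally have "(nrm (h (g e)))\<^sup>2 \<le> (?H i * B i)\<^sup>2" by (rule power_mono) simp
    then show "nrm2 ((h \<circ> g) e) \<le> (?H i * B i)\<^sup>2" by (simp add: nrm_power2)
  qed
qed

lemma energy_le_sup: "h \<in> aut \<Longrightarrow> g \<in> G \<Longrightarrow> energy (h \<circ> g) \<le> sup_energy h"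
  unfolding sup_energy_def by (rule cSUP_upper[OF _ bdd_above_energy])

lemma sup_energy_nonneg: "h \<in> aut \<Longrightarrow> 0 \<le> sup_energy h"
  using energy_le_sup[OF _ G_id] energy_nonneg order_trans by blast

lemma min_energy_le: "h \<in> aut \<Longrightarrow> min_energy \<le> sup_energy h"
  unfolding min_energy_def by (intro cINF_lower bdd_belowI2[of _ 0] sup_energy_nonneg)

lemma min_energy_nonneg: "0 \<le> min_energy"
  unfolding min_energy_def using aut_id sup_energy_nonneg by (intro cINF_greatest) auto

lemma sup_energy_translate:
  assumes "h \<in> aut" "g \<in> G"
  shows "sup_energy (h \<circ> g) \<le> sup_energy h"
  unfolding sup_energy_def[of "h \<circ> g"]
proof (rule cSUP_least)
  show "energy (h \<circ> g \<circ> g') \<le> sup_energy h" if "g' \<in> G" for g'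
    using energy_le_sup[OF assms(1) G_comp[OF assms(2) that]] by (simp only: o_assoc)
qed (use G_id in auto)

text \<open>
  Uniform convexity. The midpoint of two near-minimizers has energy nearly at least the minimum
  along some \<open>g \<in> G\<close>, which leaves no room for the polar part \<open>S\<close> to move the vectors \<open>h g e\<close>.
\<close>

lemma near_minimizers_close_on_weight_space:
  assumes c: "c > 1"
  shows "\<exists>\<delta>>0. \<forall>h\<in>aut. \<forall>h'\<in>aut. sup_energy h \<le> min_energy + \<delta> \<longrightarrow>
    sup_energy h' \<le> min_energy + \<delta> \<longrightarrow> (\<forall>x\<in>W n. nrm2 (h' x) \<le> c * nrm2 (h x))"
proof -
  obtain \<eta> where \<eta>: "\<eta> > 0" "\<And>S x. S \<in> aut \<Longrightarrow> selfadjoint S \<Longrightarrow> (\<And>i. i \<in> I \<Longrightarrow> near_id i \<eta> S) \<Longrightarrow>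
      x \<in> W n \<Longrightarrow> nrm2 (S x) \<le> c * nrm2 x"
    using selfadjoint_aut_contraction[OF c, of n] by meson
  define N where "N = 1 + (\<Sum>i\<in>I. real (card (onb i)))"
  have N: "real (card (onb i)) \<le> N" if "i \<in> I" for i
    using member_le_sum[of i I "\<lambda>i. real (card (onb i))"] that fin_I by (simp add: N_def)
  have "N \<ge> 1" by (simp add: N_def sum_nonneg)
  \<comment> \<open>\<open>K\<close> will bound \<open>k = h g\<close>, hence also its inverse, on the distinguished weight spaces\<close>
  define K where "K = N * sqrt (min_energy + 1)"
  have "K > 0" using \<open>N \<ge> 1\<close> min_energy_nonneg by (simp add: K_def)
  \<comment> \<open>the vectors \<open>k e\<close> will move by at most \<open>2 * t\<close> under \<open>S\<close>\<close>
  define t where "t = \<eta> / (2 * N * K)"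
  have "t > 0" using \<open>N \<ge> 1\<close> \<open>K > 0\<close> \<eta>(1) by (simp add: t_def)
  define \<delta> where "\<delta> = min 1 (t\<^sup>2)"
  have \<delta>: "\<delta> > 0" "\<delta> \<le> 1" "\<delta> \<le> t\<^sup>2" using \<open>t > 0\<close> by (simp_all add: \<delta>_def)
  have close: "nrm2 (h' x) \<le> c * nrm2 (h x)"
    if h: "h \<in> aut" "h' \<in> aut"
      and min: "sup_energy h \<le> min_energy + \<delta>" "sup_energy h' \<le> min_energy + \<delta>"
      and x: "x \<in> W n" for h h' x
  proof -
    obtain S R where S: "S \<in> aut" "selfadjoint S" and R: "R \<in> aut"
      and hS: "\<And>x. nrm2 (h' x) = nrm2 (S (h x))"
      and mid: "\<And>w. nrm2 (S w - w) = nrm2 (S w) + nrm2 w - 2 * nrm2 (R w)"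
      using relative_polar_part[OF h] by metis
    have "min_energy - \<delta> < sup_energy (R \<circ> h)"
      using min_energy_le[OF aut_comp[OF R h(1)]] \<delta>(1) by linarith
    then obtain g where g: "g \<in> G" and lower: "min_energy - \<delta> < energy (R \<circ> h \<circ> g)"
      unfolding sup_energy_def
      by (subst (asm) less_cSUP_iff) (use G_id bdd_above_energy[OF aut_comp[OF R h(1)]] in auto)
    define k where "k = h \<circ> g"
    have k: "k \<in> aut" unfolding k_def using h(1) g G_aut aut_comp by blast
    have "energy (\<lambda>e. S (k e) - k e) = energy (\<lambda>e. S (k e)) + energy k - 2 * energy (\<lambda>e. R (k e))"
      unfolding energy_def mid by (simp add: sum.distrib sum_subtractf sum_distrib_left)
    moreover have "energy (\<lambda>e. S (k e)) = energy (h' \<circ> g)" by (simp add: energy_def k_def hS)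
    moreover have "energy (h' \<circ> g) \<le> min_energy + \<delta>"
      using energy_le_sup[OF h(2) g] min(2) by simp
    moreover have kE: "energy k \<le> min_energy + \<delta>"
      using energy_le_sup[OF h(1) g] min(1) by (simp add: k_def)
    moreover have "energy (\<lambda>e. R (k e)) = energy (R \<circ> h \<circ> g)" by (simp add: energy_def k_def)
    ultimately have "energy (\<lambda>e. S (k e) - k e) \<le> 4 * \<delta>" using lower by linarith
    also have "\<dots> \<le> (2 * t)\<^sup>2" using \<delta>(3) by (simp add: power_mult_distrib)
    finally have diff: "energy (\<lambda>e. S (k e) - k e) \<le> (2 * t)\<^sup>2" .
    have "near_id i \<eta> S" if i: "i \<in> I" for i
      unfolding near_id_def
    proof
      fix y assume y: "y \<in> W i"
      define z where "z = inv_into UNIV k y"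
      have kz: "k z = y" unfolding z_def by (rule aut_inv_cancel(2)[OF k])
      have z: "z \<in> W i" unfolding z_def by (rule aut_W[OF aut_inv[OF k] y])
      have "nrm (k w) \<le> K * nrm w" if w: "w \<in> W i" for w
      proof -
        have "nrm2 (k e) \<le> (sqrt (min_energy + 1))\<^sup>2" if "e \<in> onb i" for e
          using basis_le_energy[OF i that, of k] kE \<delta>(2) min_energy_nonneg by simp
        then have "nrm (k w) \<le> real (card (onb i)) * sqrt (min_energy + 1) * nrm w"
          using min_energy_nonneg by (intro bound_from_basis[OF autD(1)[OF k] _ _ w]) auto
        also have "\<dots> \<le> K * nrm w"
          unfolding K_def using N[OF i] min_energy_nonneg by (intro mult_right_mono) auto
        finally show ?thesis .
      qed
      then have zy: "nrm z \<le> K * nrm y" unfolding z_def using aut_inv_bound[OF k _ y] by blast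
      have lin: "linop (\<lambda>x. S (k x) - k x)"
        using autD(1)[OF S(1)] autD(1)[OF k] by (simp add: linop_iff scale_right_diff_distrib)
      have "nrm (S (k z) - k z) \<le> real (card (onb i)) * (2 * t) * nrm z"
        using basis_le_energy[OF i, of _ "\<lambda>e. S (k e) - k e"] diff \<open>t > 0\<close>
        by (intro bound_from_basis[OF lin _ _ z]) (auto intro: order_trans)
      also have "\<dots> \<le> N * (2 * t) * (K * nrm y)"
        using N[OF i] zy \<open>t > 0\<close> \<open>N \<ge> 1\<close> by (intro mult_mono) auto
      also have "\<dots> = \<eta> * nrm y" using \<open>N \<ge> 1\<close> \<open>K > 0\<close> by (simp add: t_def)
      finally show "nrm (S y - y) \<le> \<eta> * nrm y" by (simp add: kz)
    qed
    then have "nrm2 (S (h x)) \<le> c * nrm2 (h x)" using \<eta>(2)[OF S _ aut_W[OF h(1) x]] by blast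
    then show ?thesis by (simp add: hS)
  qed
  show ?thesis using \<delta>(1) close by (intro exI[of _ \<delta>]) simp
qed

lemma near_minimizers_close:
  assumes c: "c > 1"
  obtains \<delta> where "\<delta> > 0" "\<And>h h'. h \<in> aut \<Longrightarrow> h' \<in> aut \<Longrightarrow> sup_energy h \<le> min_energy + \<delta> \<Longrightarrow>
    sup_energy h' \<le> min_energy + \<delta> \<Longrightarrow> nrm2 (h' a) \<le> c * nrm2 (h a)"
proof -
  let ?D = "{d. weight_component a d \<noteq> 0}" and ?w = "weight_component a"
  obtain \<delta> where \<delta>: "\<And>d. \<delta> d > 0" "\<And>d h h' x. h \<in> aut \<Longrightarrow> h' \<in> aut \<Longrightarrow>
      sup_energy h \<le> min_energy + \<delta> d \<Longrightarrow> sup_energy h' \<le> min_energy + \<delta> d \<Longrightarrow>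
      x \<in> W d \<Longrightarrow> nrm2 (h' x) \<le> c * nrm2 (h x)"
    using near_minimizers_close_on_weight_space[OF c] by metis
  define \<delta>0 where "\<delta>0 = Min (insert 1 (\<delta> ` ?D))"
  have fin: "finite ?D" by (rule weight_component_props(2))
  have le: "\<delta>0 \<le> \<delta> d" if "d \<in> ?D" for d
    unfolding \<delta>0_def using fin that by (intro Min_le) auto
  show ?thesis
  proof (rule that)
    show "\<delta>0 > 0" unfolding \<delta>0_def using fin \<delta>(1) by (subst Min_gr_iff) auto
    fix h h' assume h: "h \<in> aut" "h' \<in> aut"
      and min: "sup_energy h \<le> min_energy + \<delta>0" "sup_energy h' \<le> min_energy + \<delta>0"
    have "nrm2 (h' (?w d)) \<le> c * nrm2 (h (?w d))" if "d \<in> ?D" for d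
      by (rule \<delta>(2)[OF h _ _ weight_component_props(1)]) (use le[OF that] min in linarith)+
    then show "nrm2 (h' a) \<le> c * nrm2 (h a)"
      by (simp only: nrm2_weight_decomposition[OF h(1), of a] nrm2_weight_decomposition[OF h(2), of a]
          sum_distrib_left sum_mono)
  qed
qed

end


section \<open>The limit form\<close>

lemma (in complex_inner_product_space) polarization:
  "ip x y = Complex ((nrm2 (x + y) - nrm2 (x - y)) / 4) ((nrm2 (\<i> *s x + y) - nrm2 (\<i> *s x - y)) / 4)"
  by (simp add: complex_eq_iff nrm2_add nrm2_diff ip_scale_left)

context simple_unitary_voa
begin

lemma bilinear_expansion:
  assumes f: "\<And>v. Vector_Spaces.linear scl (*) (\<lambda>u. f u v)" "\<And>u. Vector_Spaces.linear scl (*) (f u)"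
    and u: "u \<in> W m" and v: "v \<in> W n"
  shows "f u v = (\<Sum>e\<in>onb m. \<Sum>e'\<in>onb n. ip e u * (ip e' v * f e e'))"
proof -
  have l: "f (x + y) v = f x v + f y v" "f (c *s x) v = c * f x v"
      "f v (x + y) = f v x + f v y" "f v (c *s x) = c * f v x" for x y v c
    using f by (simp_all add: Vector_Spaces.linear_iff)
  have sl: "f (sum g A) v = (\<Sum>i\<in>A. f (g i) v)" for g :: "'v \<Rightarrow> 'v" and A v
    using l(2)[of 0 0] by (induction A rule: infinite_finite_induct) (simp_all add: l(1))
  have sr: "f v (sum g A) = (\<Sum>i\<in>A. f v (g i))" for g :: "'v \<Rightarrow> 'v" and A v
    using l(4)[of _ 0 0] by (induction A rule: infinite_finite_induct) (simp_all add: l(3))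
  have "f u v = (\<Sum>e\<in>onb m. ip e u * f e v)"
    by (subst onb_expansion[OF u]) (simp add: sl l(2))
  moreover have "f e v = (\<Sum>e'\<in>onb n. ip e' v * f e e')" for e
    by (subst onb_expansion[OF v]) (simp add: sr l(4))
  ultimately show ?thesis by (simp add: sum_distrib_left)
qed

lemma weak_limit_bilinear:
  assumes f: "\<And>v. Vector_Spaces.linear scl (*) (\<lambda>u. f u v)" "\<And>u. Vector_Spaces.linear scl (*) (f u)"
    and W: "\<And>k. u k \<in> W m" "u' \<in> W m" "\<And>k. v k \<in> W n" "v' \<in> W n"
    and lim: "\<And>c. (\<lambda>k. ip c (u k)) \<longlonglongrightarrow> ip c u'" "\<And>c. (\<lambda>k. ip c (v k)) \<longlonglongrightarrow> ip c v'"
  shows "(\<lambda>k. f (u k) (v k)) \<longlonglongrightarrow> f u' v'"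
  unfolding bilinear_expansion[OF f W(1) W(3)] bilinear_expansion[OF f W(2) W(4)]
  by (intro tendsto_sum tendsto_mult lim tendsto_const)

text \<open>
  The relations defining an automorphism only involve finitely many matrix coefficients at a time.
  Bijectivity survives because \<open>\<theta> T \<theta>\<close> is the limit of the inverses.
\<close>

lemma weak_limit_selfadjoint_aut:
  assumes t: "\<And>k. t k \<in> aut" "\<And>k. selfadjoint (t k)" and T: "linop T"
    and lim: "\<And>a b. (\<lambda>k. ip a (t k b)) \<longlonglongrightarrow> ip a (T b)"
  shows "T \<in> aut" "selfadjoint T"
proof -
  show sa: "selfadjoint T"
    unfolding selfadjoint_def
  proof (intro allI)
    fix x y
    have "(\<lambda>k. cnj (ip y (t k x))) \<longlonglongrightarrow> cnj (ip y (T x))" by (intro tendsto_cnj lim)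
    moreover have "cnj (ip y (t k x)) = ip x (t k y)" for k
      using t(2)[of k] unfolding selfadjoint_def by (subst ip_cnj[symmetric]) blast
    ultimately have "(\<lambda>k. ip x (t k y)) \<longlonglongrightarrow> ip (T x) y" by (simp add: ip_cnj[of "T x" y])
    then show "ip (T x) y = ip x (T y)" using lim LIMSEQ_unique by blast
  qed
  have eqI: "x = T y" if "\<And>a. (\<lambda>k. ip a (t k y)) \<longlonglongrightarrow> ip a x" for x y
    using that lim LIMSEQ_unique by (intro ip_eqI) blast
  \<comment> \<open>\<open>T\<close> preserves weights, which reduces the limits below to finite sums\<close>
  have TL: "L 0 (T b) = T (L 0 b)" for b
  proof (rule eqI)
    fix a
    have "(\<lambda>k. ip (L 0 a) (t k b)) \<longlonglongrightarrow> ip (L 0 a) (T b)" by (rule lim)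
    then show "(\<lambda>k. ip a (t k (L 0 b))) \<longlonglongrightarrow> ip a (L 0 (T b))"
      by (simp add: invariant_form_L0[OF sesquilinear_ip invariant theta(5)] aut_L[OF t(1)])
  qed
  have TW: "T b \<in> W n" if "b \<in> W n" for b n
    using that by (simp add: W_iff TL linop_scale[OF T])
  have Wspan: "x \<in> span (\<Union>n. W n)" for x using weight_decomposition by simp
  have hom_W: "T (Y a j b) = Y (T a) j (T b)" if ab: "a \<in> W m" "b \<in> W n" for a b j m n
  proof (rule eqI[symmetric])
    fix c
    have "(\<lambda>k. ip c (Y (t k a) j (t k b))) \<longlonglongrightarrow> ip c (Y (T a) j (T b))"
      by (rule weak_limit_bilinear[where m = m and n = n])
        (use ab aut_W[OF t(1)] TW lim vector_space_axioms ip_linear[of 0] in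
          \<open>auto simp: Vector_Spaces.linear_iff Y_simps ip_bilinear\<close>)
    then show "(\<lambda>k. ip c (t k (Y a j b))) \<longlonglongrightarrow> ip c (Y (T a) j (T b))"
      by (simp add: autD(3)[OF t(1)])
  qed
  have hom_W': "T (Y a j b) = Y (T a) j (T b)" if a: "a \<in> W m" for a b j m
    using Wspan[of b]
  proof (induction rule: span_induct_alt)
    case (step c x y)
    then show ?case using hom_W[OF a] by (auto simp: linop_add[OF T] linop_scale[OF T] Y_simps)
  qed (simp add: linop_0[OF T] Y_simps)
  have hom: "T (Y a j b) = Y (T a) j (T b)" for a j b
    using Wspan[of a]
  proof (induction rule: span_induct_alt)
    case (step c x y)
    then show ?case using hom_W' by (auto simp: linop_add[OF T] linop_scale[OF T] Y_simps)
  qed (simp add: linop_0[OF T] Y_simps)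
  have B_W: "ip (\<theta> (T (\<theta> a))) (T b) = ip a b" if ab: "a \<in> W m" "b \<in> W n" for a b m n
  proof -
    have "(\<lambda>k. ip (\<theta> (t k (\<theta> a))) (t k b)) \<longlonglongrightarrow> ip (\<theta> (T (\<theta> a))) (T b)"
      by (rule weak_limit_bilinear[where m = m and n = n])
        (use ab aut_W[OF t(1)] TW theta_W lim vector_space_axioms ip_linear[of 0] in
          \<open>auto simp: Vector_Spaces.linear_iff ip_bilinear theta\<close>)
    then have "(\<lambda>k. ip a b) \<longlonglongrightarrow> ip (\<theta> (T (\<theta> a))) (T b)"
      by (simp add: aut_preserves_bilinear_form[OF t(1)])
    then show ?thesis by (simp add: LIMSEQ_const_iff)
  qed
  have B_W': "ip (\<theta> (T (\<theta> a))) (T b) = ip a b" if a: "a \<in> W m" for a b m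
    using Wspan[of b]
  proof (induction rule: span_induct_alt)
    case (step c x y)
    then show ?case using B_W[OF a] by (auto simp: linop_add[OF T] linop_scale[OF T] ip_bilinear)
  qed (simp add: linop_0[OF T])
  have B: "ip (\<theta> (T (\<theta> a))) (T b) = ip a b" for a b
    using Wspan[of a]
  proof (induction rule: span_induct_alt)
    case (step c x y)
    then show ?case using B_W' by (auto simp: linop_add[OF T] linop_scale[OF T] theta ip_bilinear)
  qed (simp add: linop_0[OF T] theta_0)
  have inv1: "\<theta> (T (\<theta> (T b))) = b" for b
  proof (rule ip_eqI)
    fix a
    have "ip a (\<theta> (T (\<theta> (T b)))) = cnj (ip (\<theta> a) (T (\<theta> (T b))))"
      using theta_ip[of "\<theta> a" "T (\<theta> (T b))"] by (simp add: theta)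
    also have "\<dots> = cnj (ip (T (\<theta> a)) (\<theta> (T b)))" using sa by (simp add: selfadjoint_def)
    also have "\<dots> = ip (\<theta> (T (\<theta> a))) (T b)"
      using theta_ip[of "T (\<theta> a)" "\<theta> (T b)"] by (simp add: theta)
    finally show "ip a (\<theta> (T (\<theta> (T b)))) = ip a b" by (simp add: B)
  qed
  have inv2: "T (\<theta> (T (\<theta> b))) = b" for b
    using arg_cong[OF inv1[of "\<theta> b"], of \<theta>] by (simp add: theta)
  have "bij T"
    by (rule o_bij[of "\<lambda>b. \<theta> (T (\<theta> b))"]) (simp_all add: fun_eq_iff inv1 inv2)
  moreover have "\<Omega> = T \<Omega>" "\<nu> = T \<nu>" by (rule eqI, simp add: autD[OF t(1)])+
  ultimately show "T \<in> aut" using T hom by (simp add: aut_def)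
qed

lemma transported_scalar_product:
  assumes h: "h \<in> aut"
  shows "normalized_invariant_scalar_product (\<lambda>a b. ip (h a) (h b))"
  unfolding normalized_invariant_scalar_product_def
proof (intro conjI exI)
  note h' = autD[OF h] linop_add[OF autD(1)[OF h]] linop_scale[OF autD(1)[OF h]]
  note i = autD[OF aut_inv[OF h]] linop_add[OF autD(1)[OF aut_inv[OF h]]]
    linop_scale[OF autD(1)[OF aut_inv[OF h]]]
  note c = aut_inv_cancel[OF h]
  let ?\<theta> = "inv_into UNIV h \<circ> (\<theta> \<circ> h)"
  have "Vector_Spaces.linear scl (*) (\<lambda>b. ip (h a) (h b))" for a
    using ip_linear[of 0] by (simp add: Vector_Spaces.linear_iff h' ip_bilinear)
  moreover have "ip (h b) (h a) = cnj (ip (h a) (h b))" for a b by (rule ip_cnj)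
  moreover have "a \<noteq> 0 \<longrightarrow> Re (ip (h a) (h a)) > 0" for a
    using ip_pos[of "h a"] by (simp add: aut_0_iff[OF h])
  ultimately show "scalar_product (\<lambda>a b. ip (h a) (h b))"
    unfolding scalar_product_def by blast
  show "ip (h \<Omega>) (h \<Omega>) = 1" by (simp add: h' normalized)
  have "bij ?\<theta>"
    using pct_aut h'(2) i(2) by (auto simp: antilinear_aut_def intro!: bij_comp)
  then show "antilinear_aut ?\<theta>"
    using pct_aut by (simp add: antilinear_aut_def Vector_Spaces.linear_iff h' i theta)
  show "?\<theta> \<circ> ?\<theta> = id" by (simp add: fun_eq_iff c theta)
  show "invariant_wrt ?\<theta> (\<lambda>a b. ip (h a) (h b))"
    unfolding invariant_wrt_def
  proof (intro allI)
    fix a b c' m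
    have "(\<Sum>j | opposite_coeff a j \<noteq> 0. ip (h (Y (?\<theta> (opposite_coeff a j)) (- m - 2 - j) b)) (h c'))
      = (\<Sum>j | opposite_coeff (h a) j \<noteq> 0. ip (Y (\<theta> (opposite_coeff (h a) j)) (- m - 2 - j) (h b)) (h c'))"
      by (simp add: h' c aut_opposite_coeff[OF h] aut_0_iff[OF h])
    also have "\<dots> = ip (h b) (h (Y a m c'))"
      using invariant by (simp add: invariant_wrt_def h')
    finally show "(\<Sum>j | opposite_coeff a j \<noteq> 0. ip (h (Y (?\<theta> (opposite_coeff a j)) (- m - 2 - j) b)) (h c'))
      = ip (h b) (h (Y a m c'))" .
  qed
qed

end

text \<open>
  The near-minimizers are compared multiplicatively, so the Cauchy criterion is needed in this form;
  the case \<open>c = 2\<close> supplies the bound that turns ratios into differences.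
\<close>

lemma convergent_if_ratios_tend_to_1:
  fixes u :: "nat \<Rightarrow> real"
  assumes nonneg: "\<And>k. 0 \<le> u k"
    and ratio: "\<And>c. c > 1 \<Longrightarrow> \<exists>K. \<forall>k\<ge>K. \<forall>l\<ge>K. u k \<le> c * u l"
  shows "convergent u"
proof -
  obtain K0 where K0: "\<And>k l. k \<ge> K0 \<Longrightarrow> l \<ge> K0 \<Longrightarrow> u k \<le> 2 * u l" using ratio[of 2] by auto
  define B where "B = 2 * u K0"
  have B: "B \<ge> 0" "\<And>k. k \<ge> K0 \<Longrightarrow> u k \<le> B" using nonneg K0 by (simp_all add: B_def)
  have "Cauchy u"
    unfolding Cauchy_iff
  proof (intro allI impI)
    fix e :: real assume e: "e > 0"
    define d where "d = e / (B + 1)"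
    have d: "d > 0" "d * B < e" using e B(1) by (simp_all add: d_def field_simps)
    obtain K where K: "\<And>k l. k \<ge> K \<Longrightarrow> l \<ge> K \<Longrightarrow> u k \<le> (1 + d) * u l"
      using ratio[of "1 + d"] d(1) by auto
    have le: "u k - u l < e" if "k \<ge> max K K0" "l \<ge> max K K0" for k l
    proof -
      have "u k - u l \<le> d * u l" using K[of k l] that by (simp add: algebra_simps)
      also have "\<dots> \<le> d * B" using B(2)[of l] that d(1) by simp
      finally show ?thesis using d(2) by simp
    qed
    show "\<exists>M. \<forall>m\<ge>M. \<forall>n\<ge>M. norm (u m - u n) < e"
    proof (intro exI allI impI)
      fix m n assume "max K K0 \<le> m" "max K K0 \<le> n"
      then show "norm (u m - u n) < e" using le[of m n] le[of n m] by (simp add: abs_less_iff)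
    qed
  qed
  then show ?thesis by (rule Cauchy_convergent)
qed

lemma le_if_le_mult_gt_1:
  fixes x y :: real
  assumes "y \<ge> 0" "\<And>c. c > 1 \<Longrightarrow> x \<le> c * y"
  shows "x \<le> y"
proof (rule ccontr)
  assume "\<not> x \<le> y"
  then have xy: "x > y" by simp
  show False
  proof (cases "y = 0")
    case True
    then show ?thesis using assms(2)[of 2] xy by simp
  next
    case False
    then have y: "y > 0" using assms(1) by simp
    then have "x \<le> ((x + y) / (2 * y)) * y" using xy by (intro assms(2)) (simp add: field_simps)
    also have "\<dots> = (x + y) / 2" using y by simp
    finally show ?thesis using xy by simp
  qed
qed

context bounded_aut_subgroup
begin

lemma minimizing_sequence:
  obtains h :: "nat \<Rightarrow> 'v \<Rightarrow> 'v" where "\<And>k. h k \<in> aut"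
    "\<And>\<delta>. \<delta> > 0 \<Longrightarrow> \<exists>K. \<forall>k\<ge>K. sup_energy (h k) \<le> min_energy + \<delta>"
proof -
  have "\<exists>h\<in>aut. sup_energy h < min_energy + 1 / Suc k" for k
  proof -
    have "(INF h\<in>aut. sup_energy h) < min_energy + 1 / Suc k" by (simp add: min_energy_def)
    then show ?thesis
      by (subst (asm) cINF_less_iff) (use aut_id sup_energy_nonneg in \<open>auto intro!: bdd_belowI2[of _ 0]\<close>)
  qed
  then obtain h where h: "\<And>k. h k \<in> aut" "\<And>k. sup_energy (h k) < min_energy + 1 / Suc k" by metis
  show ?thesis
  proof (rule that[OF h(1)])
    fix \<delta> :: real assume "\<delta> > 0"
    then obtain K where K: "1 / Suc K < \<delta>" using nat_approx_posE by blast
    have "sup_energy (h k) \<le> min_energy + \<delta>" if "k \<ge> K" for k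
    proof -
      have "1 / Suc k \<le> 1 / Suc K" using that by (simp add: frac_le)
      then show ?thesis using h(2)[of k] K by linarith
    qed
    then show "\<exists>K. \<forall>k\<ge>K. sup_energy (h k) \<le> min_energy + \<delta>" by blast
  qed
qed

text \<open>
  The forms \<open>(h\<^sub>k a | h\<^sub>k b)\<close> of a minimizing sequence converge. Their limit is fixed by \<open>g \<in> G\<close> since
  \<open>h\<^sub>k g\<close> is a minimizing sequence too.
\<close>

lemma fixed_positive_aut:
  obtains T where "T \<in> aut" "selfadjoint T" "\<And>x. Re (ip x (T x)) \<ge> 0"
    "\<And>g x. g \<in> G \<Longrightarrow> ip (g x) (T (g x)) = ip x (T x)"
proof -
  obtain h :: "nat \<Rightarrow> 'v \<Rightarrow> 'v" where h: "\<And>k. h k \<in> aut"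
    and min: "\<And>\<delta>. \<delta> > 0 \<Longrightarrow> \<exists>K. \<forall>k\<ge>K. sup_energy (h k) \<le> min_energy + \<delta>"
    using minimizing_sequence by blast
  note h' = linop_add[OF autD(1)[OF h]] linop_scale[OF autD(1)[OF h]] linop_diff[OF autD(1)[OF h]]
  have conv: "convergent (\<lambda>k. nrm2 (h k a))" for a
  proof (rule convergent_if_ratios_tend_to_1)
    fix c :: real assume "c > 1"
    then obtain \<delta> where \<delta>: "\<delta> > 0" "\<And>h h'. h \<in> aut \<Longrightarrow> h' \<in> aut \<Longrightarrow> sup_energy h \<le> min_energy + \<delta> \<Longrightarrow>
      sup_energy h' \<le> min_energy + \<delta> \<Longrightarrow> nrm2 (h' a) \<le> c * nrm2 (h a)"
      using near_minimizers_close[of c a] by metis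
    obtain K where "\<forall>k\<ge>K. sup_energy (h k) \<le> min_energy + \<delta>" using min[OF \<delta>(1)] by blast
    then show "\<exists>K. \<forall>k\<ge>K. \<forall>l\<ge>K. nrm2 (h k a) \<le> c * nrm2 (h l a)"
      using \<delta>(2)[OF h h] by (intro exI[of _ K]) blast
  qed simp
  define N where "N a = lim (\<lambda>k. nrm2 (h k a))" for a
  have lim2: "(\<lambda>k. nrm2 (h k a)) \<longlonglongrightarrow> N a" for a
    using conv by (simp add: N_def convergent_LIMSEQ_iff)
  have "\<exists>l. (\<lambda>k. ip (h k a) (h k b)) \<longlonglongrightarrow> l" for a b
  proof -
    have "ip (h k a) (h k b) = Complex ((nrm2 (h k (a + b)) - nrm2 (h k (a - b))) / 4)
        ((nrm2 (h k (\<i> *s a + b)) - nrm2 (h k (\<i> *s a - b))) / 4)" for k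
      by (simp add: h' polarization[of "h k a"])
    moreover have "(\<lambda>k. Complex ((nrm2 (h k (a + b)) - nrm2 (h k (a - b))) / 4)
        ((nrm2 (h k (\<i> *s a + b)) - nrm2 (h k (\<i> *s a - b))) / 4)) \<longlonglongrightarrow>
      Complex ((N (a + b) - N (a - b)) / 4) ((N (\<i> *s a + b) - N (\<i> *s a - b)) / 4)"
      by (intro tendsto_Complex tendsto_divide tendsto_diff tendsto_const lim2) simp_all
    ultimately show ?thesis by auto
  qed
  then obtain q where q: "\<And>a b. (\<lambda>k. ip (h k a) (h k b)) \<longlonglongrightarrow> q a b" by metis
  have qI: "q a b = z" if "(\<lambda>k. ip (h k a) (h k b)) \<longlonglongrightarrow> z" for a b z
    using LIMSEQ_unique[OF q that] .
  have "sesquilinear q"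
    unfolding sesquilinear_def
    by (intro conjI allI qI) (simp_all add: h' ip_bilinear tendsto_add tendsto_mult_left q)
  moreover have "q a b = 0" if "a \<in> W m" "b \<in> W n" "m \<noteq> n" for a b m n
    by (rule qI) (simp add: weights_orthogonal[OF aut_W[OF h that(1)] aut_W[OF h that(2)] that(3)])
  ultimately obtain T where T: "linop T" "\<And>a b. q a b = ip a (T b)"
    using form_representation by metis
  define t where "t k = adj (h k) \<circ> h k" for k
  have ipt: "ip a (t k b) = ip (h k a) (h k b)" for a b k by (simp add: t_def adj_left[OF h])
  have t_aut: "t k \<in> aut" for k unfolding t_def using h by (intro aut_comp adj_aut)
  have t_sa: "selfadjoint (t k)" for k
    unfolding selfadjoint_def by (subst ip_cnj) (simp add: ipt ip_cnj[of "h k _" "h k _", symmetric])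
  have t_lim: "(\<lambda>k. ip a (t k b)) \<longlonglongrightarrow> ip a (T b)" for a b
    using q[of a b] by (simp add: ipt T(2))
  note T' = weak_limit_selfadjoint_aut[OF t_aut t_sa T(1) t_lim]
  have T2: "(\<lambda>k. nrm2 (h k x)) \<longlonglongrightarrow> Re (ip x (T x))" for x
    using tendsto_Re[OF q[of x x]] by (simp add: nrm2_def T(2))
  have pos: "Re (ip x (T x)) \<ge> 0" for x
    by (rule LIMSEQ_le_const[OF T2]) simp
  have fixed: "Re (ip (g x) (T (g x))) = Re (ip x (T x))" if g: "g \<in> G" for g x
  proof -
    have hg: "h k \<circ> g \<in> aut" for k using g G_aut h aut_comp by blast
    have "Re (ip (g x) (T (g x))) \<le> c * Re (ip x (T x)) \<and> Re (ip x (T x)) \<le> c * Re (ip (g x) (T (g x)))"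
      if c: "c > 1" for c
    proof -
      obtain \<delta> where \<delta>: "\<delta> > 0" "\<And>h h'. h \<in> aut \<Longrightarrow> h' \<in> aut \<Longrightarrow> sup_energy h \<le> min_energy + \<delta> \<Longrightarrow>
        sup_energy h' \<le> min_energy + \<delta> \<Longrightarrow> nrm2 (h' x) \<le> c * nrm2 (h x)"
        using near_minimizers_close[OF c, of x] by metis
      obtain K where K: "\<And>k. k \<ge> K \<Longrightarrow> sup_energy (h k) \<le> min_energy + \<delta>" using min[OF \<delta>(1)] by blast
      have K': "sup_energy (h k \<circ> g) \<le> min_energy + \<delta>" if "k \<ge> K" for k
        using sup_energy_translate[OF h g, of k] K[OF that] by linarith
      have "nrm2 (h k (g x)) \<le> c * nrm2 (h k x)" "nrm2 (h k x) \<le> c * nrm2 (h k (g x))" if "k \<ge> K" for k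
        using \<delta>(2)[OF h hg K K', of k k] \<delta>(2)[OF hg h K' K, of k k] that by simp_all
      then show ?thesis
        by (intro conjI LIMSEQ_le[OF T2 tendsto_mult_left[OF T2]]) blast+
    qed
    then show ?thesis
      using le_if_le_mult_gt_1[OF pos] by (intro antisym) blast+
  qed
  have "ip (g x) (T (g x)) = ip x (T x)" if "g \<in> G" for g x
  proof -
    have "ip y (T y) = of_real (Re (ip y (T y)))" for y
    proof -
      have "ip y (T y) = ip (T y) y" using T'(2) by (simp add: selfadjoint_def)
      also have "\<dots> = cnj (ip y (T y))" by (rule ip_cnj)
      finally have "ip y (T y) = cnj (ip y (T y))" .
      from arg_cong[OF this, of Im] show ?thesis by (simp add: complex_eq_iff)
    qed
    then show ?thesis using fixed[OF that] by metis
  qed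
  then show ?thesis using that T' pos by blast
qed

lemma invariant_scalar_product_exists:
  "\<exists>ip'. normalized_invariant_scalar_product ip' \<and> G \<subseteq> unitary_aut ip'"
proof -
  obtain T where T: "T \<in> aut" "selfadjoint T" "\<And>x. Re (ip x (T x)) \<ge> 0"
    and fixed: "\<And>g x. g \<in> G \<Longrightarrow> ip (g x) (T (g x)) = ip x (T x)"
    using fixed_positive_aut by blast
  obtain S where S: "S \<in> aut" "selfadjoint S" "\<And>x. S (S x) = T x"
    using positive_aut_roots[OF T] by metis
  have "ip (S x) (S x) = ip x (T x)" for x using S(2,3) by (simp add: selfadjoint_def)
  then have "G \<subseteq> unitary_aut (\<lambda>a b. ip (S a) (S b))"
    using G_aut fixed by (auto simp: unitary_aut_def)
  then show ?thesis using transported_scalar_product[OF S(1)] by blast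
qed

end

theorem propositionA5:
  fixes scl :: "complex \<Rightarrow> 'v::ab_group_add \<Rightarrow> 'v"
    and Y :: "'v \<Rightarrow> int \<Rightarrow> 'v \<Rightarrow> 'v"
    and \<Omega> \<nu> :: 'v
    and ip :: "'v \<Rightarrow> 'v \<Rightarrow> complex"
    and G :: "('v \<Rightarrow> 'v) set"
  assumes "unitary_voa scl Y \<Omega> \<nu> ip"
    and "voa.simple scl Y"
    and "finite_dim_lie_group (voa.aut_group scl Y \<Omega> \<nu>) (voa.aut_topology scl Y \<Omega> \<nu>)"
    and "subgroup G (voa.aut_group scl Y \<Omega> \<nu>)"
    and "compactin (voa.aut_topology scl Y \<Omega> \<nu>) G"
  shows "\<exists>ip'. voa.normalized_invariant_scalar_product scl Y \<Omega> \<nu> ip' \<and>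
               G \<subseteq> voa.unitary_aut scl Y \<Omega> \<nu> ip'"
proof -
  interpret unitary_voa scl Y \<Omega> \<nu> ip by (rule assms(1))
  obtain \<theta> where \<theta>: "scalar_product ip" "ip \<Omega> \<Omega> = 1" "antilinear_aut \<theta>" "\<theta> \<circ> \<theta> = id" "invariant_wrt \<theta> ip"
    using ip_normalized_invariant unfolding normalized_invariant_scalar_product_def by blast
  interpret simple_unitary_voa scl Y \<Omega> \<nu> ip \<theta>
    using assms(2) \<theta> by unfold_locales
  have "locally_compact_space aut_topology"
    by (rule finite_dim_lie_group_locally_compact[OF assms(3)])
  then obtain I \<epsilon> C where I: "finite I" "\<epsilon> > 0" and
    C: "\<And>g n x. g \<in> aut \<Longrightarrow> (\<And>i. i \<in> I \<Longrightarrow> near_id i \<epsilon> g) \<Longrightarrow> x \<in> W n \<Longrightarrow> nrm (g x) \<le> C n * nrm x"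
    using locally_compact_uniform_bound by metis
  have "\<exists>b. \<forall>g\<in>G. \<forall>x\<in>W n. nrm (g x) \<le> b * nrm x" for n
    using compactin_aut_bounded[OF assms(5), of n] by metis
  then obtain B where B: "\<And>g n x. g \<in> G \<Longrightarrow> x \<in> W n \<Longrightarrow> nrm (g x) \<le> B n * nrm x" by metis
  interpret bounded_aut_subgroup scl Y \<Omega> \<nu> ip \<theta> G B I \<epsilon> C
  proof unfold_locales
    show "G \<subseteq> aut" "id \<in> G"
      using subgroup.subset[OF assms(4)] subgroup.one_closed[OF assms(4)]
      by (simp_all add: aut_group_def)
    show "g \<circ> g' \<in> G" if "g \<in> G" "g' \<in> G" for g g'
      using subgroup.m_closed[OF assms(4) that] by (simp add: aut_group_def)
  qed (fact I B C)+
  show ?thesis by (rule invariant_scalar_product_exists)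
qed

end
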